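(* Let $\rho\in\mathcal{P}$, $\beta>0$, let $\lambda$ be feasible, let $0<\xi<a$, and let $C_1>25$ and $0<C_L<1$ be constants. Assume there exist constants $d_*\in[d_0,d_1]$ and $\Lambda\in(0,\infty]$ such that $\limsup_{k\to\infty}|I_k\mathrm{e}^{kd_*}|=\Lambda$. Then there exists a sequence $\{\delta_j\}_{j\ge1}$ with $\delta_j\to0$ as $j\to\infty$, and there are positive constants \[ C'=\frac{C_L\mathrm{e}^{-2d_*}}{2\pi C_1},\quad C_2=\frac{C'a\Lambda^2\lambda^{(d_*-a)/a}}{2},\quad C_3=\ln\lambda,\quad C_4=\frac{C'a\Lambda^2}{4}, \] such that \[ E_\xi(\delta_j)\ge \begin{cases} \dfrac{C_2\,\delta_j^{(\beta+1)\left(\frac{d_*-a}{a}\right)-1}}{(\ln\delta_j-1)\left[C_3+(\beta+1)\ln\delta_j\right]} & \text{for } 0<\beta<1,\\[0.4cm] \dfrac{C_4\,\delta_j^{2\left(\frac{d_*-a}{a}\right)-1}}{(\ln\delta_j-1)\ln\delta_j} & \text{for } \beta\ge1. \end{cases} \] (The constants $C_2,C_3$ are well defined since $\lambda>0$ when $0<\beta<1$.) Moreover, if $\lim_{k\to\infty}|I_k\mathrm{e}^{kd_*}|=\Lambda$, then for all $\delta>0$ small enough \[ E_\xi(\delta)\ge \begin{cases} \dfrac{C_2\,\delta^{(\beta+1)\left(\frac{d_*-a}{a}\right)-1}}{(\ln\delta-1)\left[C_3+(\beta+1)\ln\delta\right]} & \text{for } 0<\beta<1,\\[0.4cm] \dfrac{C_4\,\delta^{2\left(\frac{d_*-a}{a}\right)-1}}{(\ln\delta-1)\ln\delta}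 & \text{for } \beta\ge1. \end{cases} \]
   Context: Fix $a>0$. For $0<\delta<1$ and constants $\beta>0$, $\lambda\in\mathbb{R}$, put $\mu=\delta+\lambda\delta^{\beta}$. The constant $\lambda$ is feasible if $\lambda>0$ when $0<\beta<1$, $\lambda\ge-1$ when $\beta=1$, $\lambda\ne0$ when $\beta>1$; then $\delta_\mu\in(0,1)$ denotes a number with $\mu\ge0$ for $0<\delta\le\delta_\mu$ (all $\delta$ considered satisfy $0<\delta\le\delta_\mu$). The dielectric constant is $\varepsilon_c=1+\mathrm{i}\mu$ for $x<0$, $\varepsilon_s=-1+\mathrm{i}\delta$ for $0\le x\le a$, $\varepsilon_m=1$ for $x>a$. Let $\mathcal{M}=\{(x,y)\in\mathbb{R}^2:x>a\}$. $\mathcal{P}$ is the set of real-valued $\rho\in L^2(\mathcal{M})\cap L^\infty(\mathcal{M})$ with compact support in $\mathcal{M}$, with $0<|\operatorname{supp}\rho|<\infty$ (Lebesgue measure) and $\int\!\!\int\rho\,\mathrm{d}y\,\mathrm{d}x=0$; $\rho$ is extended by $0$ to $\mathbb{R}^2$. Put $d_0=\min\{x:(x,y)\in\operatorname{supp}\rho\}$, $d_1=\max\{x:(x,y)\in\operatorname{supp}\rho\}$. The Fourier transform in $y$ is $\widehat f(x,k)=\int_{-\infty}^{\infty}f(x,y)\mathrm{e}^{-\mathrm{i}ky}\,\mathrm{d}y$, and $I_k=\int_{d_0}^{d_1}\widehat\rho(s,k)\mathrm{e}^{-|k|s}\,\mathrm{d}s$. The potential $V$: let $\chi_c=\varepsilon_s/\varepsilon_c$,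 $\psi_k^+=\frac{1}{2\chi_c}[(\chi_c+1)\mathrm{e}^{|k|a}+(\chi_c-1)\mathrm{e}^{-|k|a}]$, $\psi_k^-=\frac{|k|\varepsilon_s}{2\chi_c}[(\chi_c+1)\mathrm{e}^{|k|a}-(\chi_c-1)\mathrm{e}^{-|k|a}]$, $A_k=I_k/(\mathrm{e}^{-|k|a}(|k|\psi_k^++\psi_k^-))$. For $k\ne0$ set $\widehat V(x,k)=A_k\mathrm{e}^{|k|x}$ for $x<0$; $\widehat V(x,k)=\frac{A_k}{2\chi_c}[(\chi_c+1)\mathrm{e}^{|k|x}+(\chi_c-1)\mathrm{e}^{-|k|x}]$ for $0\le x\le a$; $\widehat V(x,k)=A_k\psi_k^+\cosh(|k|(x-a))+\frac{A_k\psi_k^-}{|k|}\sinh(|k|(x-a))+\frac1{|k|}\int_a^x\sinh(|k|(x'-x))\widehat\rho(x',k)\,\mathrm{d}x'$ for $x>a$. $V(x,\cdot)$ is the function whose $y$-Fourier transform is $\widehat V(x,\cdot)$; it is the (up to an additive constant unique) solution of $-\nabla\cdot(\varepsilon\nabla V)=\rho$ in $\mathbb{R}^2$ with $V$ and $\varepsilon\,\partial_xV$ continuous across $x=0,a$, $\partial_xV\to0$ as $|x|\to\infty$, $V(x,\cdot)\in H^1(\mathbb{R})$, $\partial_xV(x,\cdot)\in L^2(\mathbb{R})$. For $0<\xi<a$ the power dissipation is \[ E_\xi(\delta)=\delta\int_{a-\xi}^{a}\int_{-\infty}^{\infty}|\nabla V(x,y)|^2\,\mathrm{d}y\,\mathrm{d}x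 . \]
   Formalization: For Λ=∞ the constants C_2, C_4 would be infinite while E_ξ is finite; the bounds are proved with any finite L>0 in place of Λ (the sequence may depend on L). Positivity of the constants is not asserted, since C_3=ln λ is not positive when λ≤1. *)

theory Defs
  imports "HOL-Analysis.Analysis"
begin

definition supp :: "(real \<times> real \<Rightarrow> real) \<Rightarrow> (real \<times> real) set" where
  "supp rho = closure {p. rho p \<noteq> 0}"

text \<open>The admissible charge densities \<open>\<P>\<close> (extended by 0 outside the half plane x > a).\<close>
definition P_class :: "real \<Rightarrow> (real \<times> real \<Rightarrow> real) set" where
  "P_class a = {rho.
     rho \<in> borel_measurable lborel \<and>
     integrable lborel (\<lambda>p. (rho p)\<^sup>2) \<and>
     (\<exists>B. AE p in lborel. \<bar>rho p\<bar> \<le> B) \<and>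
     compact (supp rho) \<and> supp rho \<subseteq> {p. fst p > a} \<and>
     0 < emeasure lborel (supp rho) \<and> emeasure lborel (supp rho) < \<infinity> \<and>
     (LINT x|lborel. LINT y|lborel. rho (x, y)) = 0}"

definition d0 :: "(real \<times> real \<Rightarrow> real) \<Rightarrow> real" where
  "d0 rho = Inf (fst ` supp rho)"

definition d1 :: "(real \<times> real \<Rightarrow> real) \<Rightarrow> real" where
  "d1 rho = Sup (fst ` supp rho)"

definition rho_hat :: "(real \<times> real \<Rightarrow> real) \<Rightarrow> real \<Rightarrow> real \<Rightarrow> complex" where
  "rho_hat rho x k = (LINT y|lborel. complex_of_real (rho (x, y)) * exp (- \<i> * of_real (k * y)))"

definition I_k :: "(real \<times> real \<Rightarrow> real) \<Rightarrow> real \<Rightarrow> complex" where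
  "I_k rho k = (LINT s:{d0 rho..d1 rho}|lborel. rho_hat rho s k * of_real (exp (- \<bar>k\<bar> * s)))"

definition feasible :: "real \<Rightarrow> real \<Rightarrow> bool" where
  "feasible beta lam \<longleftrightarrow>
     (beta < 1 \<longrightarrow> lam > 0) \<and> (beta = 1 \<longrightarrow> lam \<ge> -1) \<and> (beta > 1 \<longrightarrow> lam \<noteq> 0)"

definition mu :: "real \<Rightarrow> real \<Rightarrow> real \<Rightarrow> real" where
  "mu beta lam delta = delta + lam * delta powr beta"

definition eps_s :: "real \<Rightarrow> complex" where
  "eps_s delta = Complex (-1) delta"

definition eps_c :: "real \<Rightarrow> real \<Rightarrow> real \<Rightarrow> complex" where
  "eps_c beta lam delta = Complex 1 (mu beta lam delta)"

definition chi_c :: "real \<Rightarrow> real \<Rightarrow> real \<Rightarrow> complex" where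
  "chi_c beta lam delta = eps_s delta / eps_c beta lam delta"

definition psi_plus :: "real \<Rightarrow> real \<Rightarrow> real \<Rightarrow> real \<Rightarrow> real \<Rightarrow> complex" where
  "psi_plus a beta lam delta k =
     (let ch = chi_c beta lam delta in
       1 / (2 * ch) * ((ch + 1) * of_real (exp (\<bar>k\<bar> * a)) + (ch - 1) * of_real (exp (- \<bar>k\<bar> * a))))"

definition psi_minus :: "real \<Rightarrow> real \<Rightarrow> real \<Rightarrow> real \<Rightarrow> real \<Rightarrow> complex" where
  "psi_minus a beta lam delta k =
     (let ch = chi_c beta lam delta in
       of_real \<bar>k\<bar> * eps_s delta / (2 * ch) *
         ((ch + 1) * of_real (exp (\<bar>k\<bar> * a)) - (ch - 1) * of_real (exp (- \<bar>k\<bar> * a))))"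

definition A_k :: "real \<Rightarrow> (real \<times> real \<Rightarrow> real) \<Rightarrow> real \<Rightarrow> real \<Rightarrow> real \<Rightarrow> real \<Rightarrow> complex" where
  "A_k a rho beta lam delta k =
     I_k rho k / (of_real (exp (- \<bar>k\<bar> * a)) *
       (of_real \<bar>k\<bar> * psi_plus a beta lam delta k + psi_minus a beta lam delta k))"

text \<open>y-Fourier transform of the potential (value at k = 0 is irrelevant, set to 0).\<close>
definition V_hat :: "real \<Rightarrow> (real \<times> real \<Rightarrow> real) \<Rightarrow> real \<Rightarrow> real \<Rightarrow> real \<Rightarrow> real \<Rightarrow> real \<Rightarrow> complex" where
  "V_hat a rho beta lam delta x k =
     (let A = A_k a rho beta lam delta k; ch = chi_c beta lam delta; K = \<bar>k\<bar> in
      if k = 0 then 0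
      else if x < 0 then A * of_real (exp (K * x))
      else if x \<le> a then A / (2 * ch) * ((ch + 1) * of_real (exp (K * x)) + (ch - 1) * of_real (exp (- K * x)))
      else A * psi_plus a beta lam delta k * of_real (cosh (K * (x - a)))
           + A * psi_minus a beta lam delta k / of_real K * of_real (sinh (K * (x - a)))
           + 1 / of_real K * (LINT x':{a..x}|lborel. of_real (sinh (K * (x' - x))) * rho_hat rho x' k))"

definition V :: "real \<Rightarrow> (real \<times> real \<Rightarrow> real) \<Rightarrow> real \<Rightarrow> real \<Rightarrow> real \<Rightarrow> real \<times> real \<Rightarrow> complex" where
  "V a rho beta lam delta p =
     1 / (2 * of_real pi) * (LINT k|lborel. V_hat a rho beta lam delta (fst p) k * exp (\<i> * of_real (k * snd p)))"

definition grad_V_sq :: "real \<Rightarrow> (real \<times> real \<Rightarrow> real) \<Rightarrow> real \<Rightarrow> real \<Rightarrow> real \<Rightarrow> real \<Rightarrow> real \<Rightarrow> real" where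
  "grad_V_sq a rho beta lam delta x y =
     (norm (vector_derivative (\<lambda>t. V a rho beta lam delta (t, y)) (at x)))\<^sup>2
   + (norm (vector_derivative (\<lambda>t. V a rho beta lam delta (x, t)) (at y)))\<^sup>2"

definition E_xi :: "real \<Rightarrow> (real \<times> real \<Rightarrow> real) \<Rightarrow> real \<Rightarrow> real \<Rightarrow> real \<Rightarrow> real \<Rightarrow> ennreal" where
  "E_xi a rho beta lam xi delta =
     ennreal delta * (\<integral>\<^sup>+ x. indicator {a - xi..a} x *
        (\<integral>\<^sup>+ y. ennreal (grad_V_sq a rho beta lam delta x y) \<partial>lborel) \<partial>lborel)"

end

theory Submission
  imports Defs "HOL-Complex_Analysis.Complex_Analysis" "HOL-Probability.Probability"
    "HOL-Real_Asymp.Real_Asymp"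
begin

text \<open>In the slab the transform of the potential is
  \<open>I\<^sub>k e\<^sup>K\<^sup>a (\<i> (\<delta> + \<mu>) e\<^sup>K\<^sup>x + (-2 + \<i> (\<delta> - \<mu>)) e\<^sup>-\<^sup>K\<^sup>x) / (K D)\<close> with \<open>K = \<bar>k\<bar>\<close> and
  \<open>D \<approx> - \<delta> (\<delta> + \<mu>) e\<^sup>K\<^sup>a - 4 e\<^sup>-\<^sup>K\<^sup>a\<close>. Choose \<open>k\<^sub>0\<close> so that the two terms of \<open>D\<close> are of the same order and
  keep only the frequencies in \<open>[k\<^sub>0, k\<^sub>0 + 1]\<close>, the strip \<open>a - 1/k\<^sub>0 \<le> x \<le> a\<close> and the \<open>y\<close>-derivative of
  the potential. With \<open>F(k) = I\<^sub>k e\<^sup>k\<^sup>d\<close>, \<open>d = d\<^sub>*\<close>, half of Plancherel's identity then yields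
  \<open>E\<^sub>\<xi>(\<delta>) \<ge> c \<delta>\<^sup>-\<^sup>1 exp (-2 k\<^sub>0 (d - a)) k\<^sub>0\<^sup>-\<^sup>1 \<integral>\<bar>F\<bar>\<^sup>2\<close> over \<open>[k\<^sub>0, k\<^sub>0 + 1]\<close>, whereas the claimed bound is
  \<open>O(\<delta>\<^sup>-\<^sup>1 exp (-2 k\<^sub>0 (d - a)) k\<^sub>0\<^sup>-\<^sup>2)\<close>. So it suffices that \<open>\<integral>\<bar>F\<bar>\<^sup>2 \<ge> C/k\<^sub>0\<close>. This is clear for all large \<open>k\<^sub>0\<close>
  if \<open>\<bar>F\<bar>\<close> has a positive limit. If only the upper limit is positive, it holds for arbitrarily large
  \<open>k\<^sub>0\<close>, since \<open>F\<close> extends to an entire function of exponential type, and a Phragmen-Lindelof argument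
  shows that \<open>\<integral>\<bar>F\<bar>\<^sup>2 \<le> C/k\<^sub>0\<close> for all large \<open>k\<^sub>0\<close> would force \<open>F(k) \<rightarrow> 0\<close>.\<close>

section \<open>Functions of exponential type on a half plane\<close>

text \<open>For nonzero \<open>u\<close> the hypothesis bounds the argument of \<open>u\<close> by
  pi/4, so \<open>u * csqrt u\<close> has argument at most 3 pi/8 and real part at least cos (3
  pi/8) times its modulus. The value 1/16 is a crude form of that cosine, obtained algebraically
  from the real and imaginary parts of \<open>csqrt u\<close>.\<close>

lemma Re_csqrt_cubed_ge:
  assumes "\<bar>Im u\<bar> \<le> Re u"
  shows "norm u * sqrt (norm u) / 16 \<le> Re (u * csqrt u)"
proof -
  define p q where "p = Re (csqrt u)" and "q = Im (csqrt u)"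
  have p0: "p \<ge> 0" unfolding p_def by (rule Re_csqrt)
  have sq: "csqrt u * csqrt u = u" by (metis power2_csqrt power2_eq_square)
  have cs: "csqrt u = Complex p q" by (simp add: p_def q_def del: csqrt.simps)
  have u: "u = Complex (p*p - q*q) (2*p*q)"
    using sq unfolding cs by (simp add: complex_eq_iff del: csqrt.simps)
  have Re: "Re (u * csqrt u) = p * (p*p - 3*q*q)"
    unfolding cs by (subst u) (simp add: algebra_simps)
  have h: "2*(p*\<bar>q\<bar>) \<le> p*p - q*q"
  proof -
    have Ru: "Re u = p*p - q*q" by (subst u) simp
    have Iu: "Im u = 2*p*q" by (subst u) simp
    have "\<bar>Im u\<bar> = 2*(p*\<bar>q\<bar>)" unfolding Iu using p0 by (simp only: abs_mult abs_of_nonneg abs_numeral mult.assoc)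
    then show ?thesis using assms Ru by linarith
  qed
  \<comment> \<open>The slope 1/2 rounds up tan (pi/8): beyond it, 2 p |q| would reach p^2 and thus
    exceed p^2 - q^2, against \<open>h\<close>.\<close>
  have q: "\<bar>q\<bar> \<le> p/2"
  proof (rule ccontr)
    assume "\<not> \<bar>q\<bar> \<le> p/2"
    then have a: "\<bar>q\<bar> > p/2" by simp
    then have "\<bar>q\<bar> > 0" using p0 by linarith
    moreover have "p*p \<le> 2*(p*\<bar>q\<bar>)" using mult_left_mono[of "p/2" "\<bar>q\<bar>" p] a p0 by simp
    ultimately have "p*p \<le> 2*(p*\<bar>q\<bar>)" "0 < \<bar>q\<bar>*\<bar>q\<bar>" by (auto simp only: mult_pos_pos)
    moreover have "q*q = \<bar>q\<bar>*\<bar>q\<bar>" by simp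
    ultimately show False using h by linarith
  qed
  have nv: "norm (csqrt u) = sqrt (norm u)" by (rule norm_csqrt)
  have nu: "norm u = norm (csqrt u) * norm (csqrt u)" by (metis sq norm_mult)
  have nn: "norm u * sqrt (norm u) = norm (csqrt u) ^ 3"
    unfolding nv[symmetric] by (subst nu) (simp add: power3_eq_cube)
  have "norm (csqrt u) \<le> \<bar>p\<bar> + \<bar>q\<bar>" unfolding p_def q_def by (rule cmod_le)
  then have "norm (csqrt u) \<le> 3/2 * p" using q p0 by linarith
  then have "norm (csqrt u) ^ 3 \<le> (3/2*p)^3" by (intro power_mono) auto
  also have "\<dots> \<le> 4 * p^3" using p0 by (simp add: power_mult_distrib power3_eq_cube)
  finally have 1: "norm (csqrt u) ^ 3 / 16 \<le> p^3/4" by simp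
  have "q*q = \<bar>q\<bar>*\<bar>q\<bar>" by simp
  also have "\<dots> \<le> (p/2)*(p/2)" using q p0 by (intro mult_mono) auto
  finally have "p*p/4 \<le> p*p - 3*q*q" by (simp add: algebra_simps)
  then have "p * (p*p/4) \<le> p*(p*p - 3*q*q)" using p0 by (rule mult_left_mono)
  then show ?thesis using 1 unfolding nn Re by (simp add: power3_eq_cube)
qed

text \<open>The classical multiplier \<open>exp (-e u\<^sup>3\<^sup>/\<^sup>2)\<close>, with \<open>u = (z + 1 + \<i>) (1 - \<i>)\<close> the
  rotated quadrant, beats exponential type and is harmless as \<open>e\<close> tends to 0.\<close>
lemma phragmen_lindelof_quadrant:
  assumes holf: "f holomorphic_on UNIV"
    and growth: "\<And>z. Re z \<ge> 0 \<Longrightarrow> Im z \<ge> 0 \<Longrightarrow> norm (f z) \<le> C * exp (\<tau> * norm z)"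
    and real: "\<And>x. x \<ge> 0 \<Longrightarrow> norm (f (of_real x)) \<le> M"
    and imag: "\<And>y. y \<ge> 0 \<Longrightarrow> norm (f (\<i> * of_real y)) \<le> M"
    and M: "M > 0" and z: "Re z \<ge> 0" "Im z \<ge> 0"
  shows "norm (f z) \<le> M"
proof -
  \<comment> \<open>Here u z = (1 - i) z + 2. The rotation puts the quadrant into the sector of
    \<open>Re_csqrt_cubed_ge\<close>, and the shift gives Re (u z) \<ge> 2 there, away from the
    branch cut of \<open>csqrt\<close>.\<close>
  define u where "u = (\<lambda>z. (z + 1 + \<i>) * (1 - \<i>))"
  define w where "w = (\<lambda>z. u z * csqrt (u z))"
  define Q where "Q = {z. Re z \<ge> 0 \<and> Im z \<ge> 0}"
  have Reu: "Re (u z) = Re z + Im z + 2" "Im (u z) = Im z - Re z" for z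
    by (simp_all add: u_def algebra_simps)
  have nu: "norm z \<le> norm (u z)" if "z \<in> Q" for z
  proof -
    have "norm z \<le> Re z + Im z" using cmod_le[of z] that by (simp add: Q_def)
    also have "\<dots> \<le> Re (u z)" by (simp add: Reu)
    finally show ?thesis using complex_Re_le_cmod order_trans by blast
  qed
  have wge: "norm z * sqrt (norm z) / 16 \<le> Re (w z)" if "z \<in> Q" for z
  proof -
    have "norm z * sqrt (norm z) / 16 \<le> norm (u z) * sqrt (norm (u z)) / 16"
      using nu[OF that] by (intro divide_right_mono mult_mono) auto
    also have "\<dots> \<le> Re (w z)" unfolding w_def
      by (rule Re_csqrt_cubed_ge) (use that in \<open>auto simp: Reu Q_def\<close>)
    finally show ?thesis .
  qed
  have wge0: "0 \<le> Re (w z)" if "z \<in> Q" for z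
    using wge[OF that] by (smt (verit, best) divide_nonneg_nonneg mult_nonneg_nonneg norm_ge_zero real_sqrt_ge_zero)
  have holw: "w holomorphic_on Q"
  proof -
    have u: "u holomorphic_on Q" unfolding u_def by (intro holomorphic_intros)
    have "Re (u z) > 0" if "z \<in> Q" for z using that by (simp add: Reu Q_def)
    then have "u z \<notin> \<real>\<^sub>\<le>\<^sub>0" if "z \<in> Q" for z
      using that by (metis complex_nonpos_Reals_iff not_le)
    with u show ?thesis unfolding w_def by (intro holomorphic_on_mult holomorphic_on_csqrt') auto
  qed
  have key: "norm (f z) * exp (- e * Re (w z)) \<le> M" if e: "e > 0" for e
  proof -
    define g where "g = (\<lambda>z. f z * exp (- of_real e * w z))"
    have ng: "norm (g z) = norm (f z) * exp (- e * Re (w z))" for z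
      by (simp add: g_def norm_mult)
    have ngf: "norm (g z) \<le> norm (f z)" if "z \<in> Q" for z
      unfolding ng using wge0[OF that] e
      by (intro mult_left_le) (auto simp: mult_nonneg_nonneg)
    \<comment> \<open>On the arc of radius R the multiplier is at most exp (-e R^(3/2) / 16), which
      beats exp (\<tau> R). A large R therefore puts the arc below \<open>M\<close>, and the two
      axes remain.\<close>
    have "((\<lambda>R. C * exp (\<tau> * R - e * (R * sqrt R / 16))) \<longlongrightarrow> 0) at_top"
      using e by real_asymp
    then have "eventually (\<lambda>R. C * exp (\<tau> * R - e * (R * sqrt R / 16)) < M) at_top"
      using M by (simp add: order_tendstoD)
    then have "eventually (\<lambda>R. C * exp (\<tau> * R - e * (R * sqrt R / 16)) < M \<and> R > norm z) at_top"
      using eventually_gt_at_top by (rule eventually_conj)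
    then obtain R where R: "C * exp (\<tau> * R - e * (R * sqrt R / 16)) < M" "R > norm z"
      by (auto simp: eventually_at_top_linorder)
    define S where "S = Q \<inter> cball 0 R"
    have clQ: "closed Q" unfolding Q_def
      by (intro closed_Collect_conj closed_Collect_le continuous_intros)
    have clS: "closed S" unfolding S_def using clQ by auto
    have holg: "g holomorphic_on Q" unfolding g_def
      by (intro holomorphic_intros holw holomorphic_on_subset[OF holf]) auto
    have SQ: "S \<subseteq> Q" by (auto simp: S_def)
    have "norm (g z) \<le> M"
    proof (rule maximum_modulus_frontier[of g S])
      show "g holomorphic_on interior S"
        using holg SQ interior_subset by (meson holomorphic_on_subset)
      show "continuous_on (closure S) g"
        using holg SQ clS by (simp add: holomorphic_on_imp_continuous_on holomorphic_on_subset)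
      show "bounded S" unfolding S_def by auto
      show "z \<in> S" using R z by (simp add: S_def Q_def)
      fix v assume v: "v \<in> frontier S"
      have vS: "v \<in> S" using v clS by (simp add: frontier_def)
      have vQ: "v \<in> Q" using vS SQ by auto
      have "\<not> (Re v > 0 \<and> Im v > 0 \<and> norm v < R)"
      proof
        assume a: "Re v > 0 \<and> Im v > 0 \<and> norm v < R"
        have "open {z. Re z > 0 \<and> Im z > 0 \<and> norm z < R}"
          by (intro open_Collect_conj open_Collect_less continuous_intros)
        moreover have "{z. Re z > 0 \<and> Im z > 0 \<and> norm z < R} \<subseteq> S"
          by (auto simp: S_def Q_def)
        ultimately have "v \<in> interior S" using a by (intro interiorI) auto
        with v show False by (simp add: frontier_def)
      qed
      then consider "Re v = 0" | "Im v = 0" | "norm v = R"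
        using vS by (force simp: S_def Q_def)
      then show "norm (g v) \<le> M"
      proof cases
        case 1
        then have "v = \<i> * of_real (Im v)" by (simp add: complex_eq_iff)
        then show ?thesis using imag[of "Im v"] vQ ngf[OF vQ] by (simp add: Q_def)
      next
        case 2
        then have "v = of_real (Re v)" by (simp add: complex_eq_iff)
        then show ?thesis using real[of "Re v"] vQ ngf[OF vQ] by (simp add: Q_def)
      next
        case 3
        have "norm (g v) \<le> C * exp (\<tau> * R) * exp (- e * Re (w v))"
          unfolding ng using growth[of v] vQ 3 by (intro mult_right_mono) (auto simp: Q_def)
        also have "\<dots> \<le> C * exp (\<tau> * R) * exp (- e * (R * sqrt R / 16))"
        proof (rule mult_left_mono)
          show "exp (- e * Re (w v)) \<le> exp (- e * (R * sqrt R / 16))"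
            using wge[OF vQ] e 3 by simp
          have "0 \<le> C * exp (\<tau> * norm v)" using growth[of v] vQ
            by (smt (verit) Q_def mem_Collect_eq norm_ge_zero)
          then show "0 \<le> C * exp (\<tau> * R)" using 3 by simp
        qed
        also have "\<dots> = C * exp (\<tau> * R - e * (R * sqrt R / 16))"
          by (simp add: mult_exp_exp)
        finally show ?thesis using R by simp
      qed
    qed
    then show ?thesis by (simp add: ng)
  qed
  have "((\<lambda>e. norm (f z) * exp (- e * Re (w z))) \<longlongrightarrow> norm (f z) * exp (- 0 * Re (w z))) (at_right 0)"
    by (intro tendsto_intros)
  then show ?thesis
    using key by (intro tendsto_upperbound[where F = "at_right 0"])
      (auto simp: eventually_at_right_less eventually_at_filter)
qed

text \<open>Phragmen-Lindelof for G(z)^2 (z + 1) exp (2 i (\<tau> + 1) z). Squaring avoids a root of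
  z + 1. The exponential has modulus 1 on the real axis, where the product is bounded by
  \<open>c\<close>. On the imaginary axis it cancels both the growth exp (2 \<tau> y) of G^2 and the
  factor |i y + 1| \<le> exp (2 y), which leaves C^2.\<close>

lemma quadrant_decay:
  assumes holG: "G holomorphic_on UNIV"
    and growth: "\<And>z. Re z \<ge> 0 \<Longrightarrow> norm (G z) \<le> C * exp (\<tau> * norm z)"
    and real: "\<And>x. x \<ge> 0 \<Longrightarrow> (norm (G (of_real x)))\<^sup>2 \<le> c / (x + 1)"
    and c: "c > 0" and \<tau>: "\<tau> \<ge> 0" and z: "Re z \<ge> 0" "Im z \<ge> 0"
  shows "(norm (G z))\<^sup>2 * norm (z + 1) \<le> (c + C\<^sup>2) * exp (2 * (\<tau> + 1) * Im z)"
proof -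
  define f where "f = (\<lambda>z. (G z)\<^sup>2 * (z + 1) * exp (2 * \<i> * of_real (\<tau> + 1) * z))"
  have nf: "norm (f z) = (norm (G z))\<^sup>2 * norm (z + 1) * exp (- 2 * (\<tau> + 1) * Im z)" for z
    by (simp add: f_def norm_mult norm_power) (simp add: algebra_simps)
  have G2: "(norm (G z))\<^sup>2 \<le> C\<^sup>2 * exp (2 * \<tau> * norm z)" if "Re z \<ge> 0" for z
  proof -
    have "(norm (G z))\<^sup>2 \<le> (C * exp (\<tau> * norm z))\<^sup>2"
      using growth[OF that] by (intro power_mono) auto
    also have "\<dots> = C\<^sup>2 * exp (2 * \<tau> * norm z)"
      by (simp add: power_mult_distrib exp_double[symmetric] mult.assoc)
    finally show ?thesis .
  qed
  have "norm (f z) \<le> c + C\<^sup>2"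
  proof (rule phragmen_lindelof_quadrant[where f = f and z = z and C = "C\<^sup>2" and \<tau> = "2 * \<tau> + 1"])
    show "f holomorphic_on UNIV" unfolding f_def by (intro holomorphic_intros holG)
    show "norm (f z) \<le> C\<^sup>2 * exp ((2 * \<tau> + 1) * norm z)" if "Re z \<ge> 0" "Im z \<ge> 0" for z
    proof -
      have "norm (f z) \<le> (C\<^sup>2 * exp (2 * \<tau> * norm z)) * exp (norm z) * 1"
        unfolding nf
      proof (intro mult_mono)
        show "norm (z + 1) \<le> exp (norm z)"
          using norm_triangle_ineq[of z 1] exp_ge_add_one_self[of "norm z"] unfolding norm_one by linarith
      qed (use G2 that \<tau> in \<open>auto intro!: mult_nonpos_nonneg\<close>)
      also have "\<dots> = C\<^sup>2 * exp ((2 * \<tau> + 1) * norm z)"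
        by (simp add: mult_exp_exp algebra_simps)
      finally show ?thesis .
    qed
    show "norm (f (of_real x)) \<le> c + C\<^sup>2" if "x \<ge> 0" for x
    proof -
      have "norm (complex_of_real x + 1) = x + 1"
        using that by (metis abs_of_nonneg add_nonneg_nonneg norm_of_real of_real_1 of_real_add zero_le_one)
      then have "norm (f (of_real x)) = (norm (G (of_real x)))\<^sup>2 * (x + 1)" by (simp add: nf)
      also have "\<dots> \<le> c" using real[OF that] that by (simp add: field_simps)
      finally show ?thesis by (smt (verit) zero_le_power2)
    qed
    show "norm (f (\<i> * of_real y)) \<le> c + C\<^sup>2" if "y \<ge> 0" for y
    proof -
      have "norm (\<i> * complex_of_real y + 1) \<le> y + 1"
        using norm_triangle_ineq[of "\<i> * complex_of_real y" 1] that by (simp add: norm_mult)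
      also have "\<dots> \<le> exp (2 * y)" using exp_ge_add_one_self[of "2 * y"] that by linarith
      finally have 1: "norm (\<i> * complex_of_real y + 1) \<le> exp (2 * y)" .
      have "norm (f (\<i> * of_real y)) \<le> (C\<^sup>2 * exp (2 * \<tau> * y)) * exp (2 * y) * exp (- 2 * (\<tau> + 1) * y)"
        unfolding nf using G2[of "\<i> * of_real y"] that 1
        by (intro mult_mono) (auto simp: norm_mult)
      also have "\<dots> = C\<^sup>2" by (simp add: mult_exp_exp mult.assoc) (simp add: algebra_simps)
      finally show ?thesis using c by simp
    qed
    show "c + C\<^sup>2 > 0" using c by (simp add: add_pos_nonneg)
  qed (use z in auto)
  then have "norm (f z) * exp (2 * (\<tau> + 1) * Im z) \<le> (c + C\<^sup>2) * exp (2 * (\<tau> + 1) * Im z)"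
    by (intro mult_right_mono) auto
  moreover have "exp (- 2 * (\<tau> + 1) * Im z) * exp (2 * (\<tau> + 1) * Im z) = 1"
    by (simp add: exp_add[symmetric] algebra_simps)
  ultimately show ?thesis unfolding nf by (simp only: mult.assoc mult_1_right)
qed

text \<open>If \<open>P' = F\<close>, the differences \<open>P (z + t) - P z\<close> decay on the real axis, hence by
  Phragmen-Lindelof in a strip; Cauchy's inequality then makes \<open>F (k + t) - F k\<close> small, so that
  \<open>F k\<close> is close to its mean over \<open>[k, k + 1]\<close>.\<close>
lemma exp_type_small_mean_imp_tendsto_0:
  assumes holF: "F holomorphic_on UNIV"
    and growth: "\<And>z. Re z \<ge> 0 \<Longrightarrow> norm (F z) \<le> C * exp (\<tau> * norm z)"
    and \<tau>: "\<tau> \<ge> 0" and c: "c > 0"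
    and mean: "\<And>k. k \<ge> 0 \<Longrightarrow> integral {k..k + 1} (\<lambda>t. (norm (F (of_real t)))\<^sup>2) \<le> c / (k + 1)"
  shows "((\<lambda>k. F (of_real k)) \<longlongrightarrow> 0) at_top"
proof -
  have "\<exists>P. \<forall>z. (P has_field_derivative F z) (at z)"
    using holomorphic_convex_primitive'[of UNIV F] holF by (metis UNIV_I convex_UNIV open_UNIV)
  then obtain P where P: "\<And>z. (P has_field_derivative F z) (at z)" by blast
  define G where "G = (\<lambda>t z. P (z + of_real t) - P z)"
  have contF: "continuous_on A F" for A
    using holF holomorphic_on_imp_continuous_on continuous_on_subset by blast
  have contFr: "continuous_on A (\<lambda>t. F (of_real t))" for A :: "real set"
    by (rule continuous_on_compose2[OF contF[of UNIV] continuous_on_of_real[OF continuous_on_id]]) auto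
  have C0: "0 \<le> C" using order_trans[OF norm_ge_zero growth[of 0]] by simp
  have derG: "(G t has_field_derivative (F (z + of_real t) - F z)) (at z)" for t z
    unfolding G_def
    by (rule DERIV_diff[OF P[of "z + of_real t", unfolded DERIV_shift] P])
  have holG: "G t holomorphic_on UNIV" for t
    using derG
    by (auto simp: holomorphic_on_def field_differentiable_def)
  have growthG: "norm (G t z) \<le> (C * exp \<tau>) * exp (\<tau> * norm z)"
    if "Re z \<ge> 0" "0 \<le> t" "t \<le> 1" for t z
  proof -
    have seg: "Re v \<ge> 0 \<and> norm v \<le> norm z + 1" if v: "v \<in> closed_segment z (z + of_real t)" for v
    proof -
      obtain s where s: "0 \<le> s" "s \<le> 1" "v = (1 - s) *\<^sub>R z + s *\<^sub>R (z + of_real t)"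
        using v by (auto simp: closed_segment_def)
      then have v': "v = z + of_real (s * t)" by (simp add: scaleR_conv_of_real algebra_simps)
      have "0 \<le> s * t" "s * t \<le> 1" using s \<open>0 \<le> t\<close> \<open>t \<le> 1\<close> by (auto intro: mult_le_one)
      then show ?thesis unfolding v' using \<open>Re z \<ge> 0\<close> norm_triangle_ineq[of z "of_real (s*t)"]
        by (auto simp del: of_real_mult)
    qed
    have "norm (P (z + of_real t) - P z) \<le> (C * exp (\<tau> * (norm z + 1))) * norm (z + of_real t - z)"
    proof (rule field_differentiable_bound[where f' = F and S = "closed_segment z (z + of_real t)"])
      fix v assume v: "v \<in> closed_segment z (z + of_real t)"
      have "norm (F v) \<le> C * exp (\<tau> * norm v)" using growth seg[OF v] by auto
      also have "\<dots> \<le> C * exp (\<tau> * (norm z + 1))" using seg[OF v] \<tau> C0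
        by (intro mult_left_mono) (auto intro!: mult_left_mono)
      finally show "norm (F v) \<le> C * exp (\<tau> * (norm z + 1))" .
    qed (auto intro: has_field_derivative_at_within[OF P])
    also have "\<dots> \<le> (C * exp (\<tau> * (norm z + 1))) * 1" using that C0
      by (intro mult_left_mono) auto
    finally show ?thesis by (simp add: G_def mult_exp_exp algebra_simps)
  qed
  have intF: "((\<lambda>u. F (of_real u)) has_integral G t (of_real k)) {k..k+t}" if "t \<ge> 0" for k t :: real
  proof -
    have "((\<lambda>u. F (of_real u)) has_integral P (of_real (k + t)) - P (of_real k)) {k..k+t}"
    proof (rule fundamental_theorem_of_calculus)
      fix x show "((\<lambda>x. P (of_real x)) has_vector_derivative F (of_real x)) (at x within {k..k+t})"
        by (rule has_vector_derivative_at_within[OF has_vector_derivative_real_field[OF P]])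
    qed (use that in auto)
    then show ?thesis by (simp add: G_def)
  qed
  have realG: "(norm (G t (of_real k)))\<^sup>2 \<le> c / (k + 1)" if k: "k \<ge> 0" and t: "0 \<le> t" "t \<le> 1" for k t
  proof -
    \<comment> \<open>Weighted AM-GM, |F| \<le> (|F|^2 / l + l) / 2, takes the place of
      Cauchy-Schwarz. This \<open>l\<close> makes the two terms equal after integration over
      [k, k + 1].\<close>
    define l where "l = sqrt (c / (k + 1))"
    have l: "l > 0" "l * l = c / (k + 1)" using c k by (auto simp: l_def)
    have "norm (G t (of_real k)) = norm (integral {k..k+t} (\<lambda>u. F (of_real u)))"
      using intF t by (metis integral_unique)
    also have "\<dots> \<le> integral {k..k+t} (\<lambda>u. ((norm (F (of_real u)))\<^sup>2 / l + l) / 2)"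
    proof (rule integral_norm_bound_integral)
      show "(\<lambda>u. F (of_real u)) integrable_on {k..k+t}" using intF t by blast
      show "(\<lambda>u. ((norm (F (of_real u)))\<^sup>2 / l + l) / 2) integrable_on {k..k+t}"
        using l by (intro integrable_continuous_interval continuous_intros contFr) auto
      fix u
      have "0 \<le> (norm (F (of_real u)) - l)\<^sup>2 / l" using l by simp
      then show "norm (F (of_real u)) \<le> ((norm (F (of_real u)))\<^sup>2 / l + l) / 2"
        using l by (simp add: power2_eq_square field_simps)
    qed
    also have "\<dots> \<le> integral {k..k+1} (\<lambda>u. ((norm (F (of_real u)))\<^sup>2 / l + l) / 2)"
      using t l by (intro integral_subset_le integrable_continuous_interval continuous_intros contFr) auto
    also have "\<dots> = (integral {k..k+1} (\<lambda>u. (norm (F (of_real u)))\<^sup>2) / l + l) / 2"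
    proof -
      have "((\<lambda>u. (norm (F (of_real u)))\<^sup>2) has_integral integral {k..k+1} (\<lambda>u. (norm (F (of_real u)))\<^sup>2)) {k..k+1}"
        by (intro integrable_integral integrable_continuous_interval continuous_intros contFr)
      from has_integral_divide[OF has_integral_add[OF has_integral_divide[OF this, of l] has_integral_const_real[of l k "k+1"]], of 2]
      have "((\<lambda>u. ((norm (F (of_real u)))\<^sup>2 / l + l) / 2) has_integral
          (integral {k..k+1} (\<lambda>u. (norm (F (of_real u)))\<^sup>2) / l + l) / 2) {k..k+1}" by simp
      then show ?thesis by (rule integral_unique)
    qed
    also have "\<dots> \<le> (c / (k+1) / l + l) / 2"
      using mean[OF k] l by (intro divide_right_mono add_right_mono) auto
    also have "\<dots> = l" using l(1) unfolding l(2)[symmetric] by simp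
    finally have "(norm (G t (of_real k)))\<^sup>2 \<le> l\<^sup>2" by (intro power_mono) auto
    then show ?thesis using l by (simp add: power2_eq_square)
  qed
  define M where "M = (c + (C * exp \<tau>)\<^sup>2) * exp (2 * (\<tau> + 1))"
  have M0: "M > 0" unfolding M_def using c by (simp add: add_pos_nonneg)
  have strip: "(norm (G t z))\<^sup>2 * norm (z + 1) \<le> M"
    if z: "Re z \<ge> 0" "\<bar>Im z\<bar> \<le> 1" and t: "0 \<le> t" "t \<le> 1" for t z
  proof -
    have "(norm (G t z))\<^sup>2 * norm (z + 1) \<le> (c + (C * exp \<tau>)\<^sup>2) * exp (2 * (\<tau> + 1) * \<bar>Im z\<bar>)"
    proof (cases "Im z \<ge> 0")
      case True
      have "(norm (G t z))\<^sup>2 * norm (z + 1) \<le> (c + (C * exp \<tau>)\<^sup>2) * exp (2 * (\<tau> + 1) * Im z)"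
        by (rule quadrant_decay[OF holG]) (use growthG realG c \<tau> z t True in auto)
      then show ?thesis using True by simp
    next
      case False
      \<comment> \<open>The lower half of the strip is reflected to the upper one: \<open>H\<close>
        satisfies the same growth bound, and the same bound on the real axis, as
        \<open>G t\<close>.\<close>
      define H where "H = cnj \<circ> G t \<circ> cnj"
      have "(norm (H (cnj z)))\<^sup>2 * norm (cnj z + 1) \<le> (c + (C * exp \<tau>)\<^sup>2) * exp (2 * (\<tau> + 1) * Im (cnj z))"
      proof (rule quadrant_decay)
        show "H holomorphic_on UNIV" unfolding H_def
          by (rule holomorphic_on_compose_cnj_cnj) (auto intro: holomorphic_on_subset[OF holG])
        show "norm (H z) \<le> C * exp \<tau> * exp (\<tau> * norm z)" if "Re z \<ge> 0" for z
          using growthG[of "cnj z" t] that t by (simp add: H_def)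
        show "(norm (H (of_real x)))\<^sup>2 \<le> c / (x + 1)" if "x \<ge> 0" for x
          using realG[of x t] that t by (simp add: H_def)
      qed (use z False c \<tau> in auto)
      moreover have "norm (cnj z + 1) = norm (z + 1)"
        by (metis complex_cnj_add complex_cnj_one complex_mod_cnj)
      ultimately show ?thesis using False by (simp add: H_def)
    qed
    also have "\<dots> \<le> M" unfolding M_def using z \<tau> c
      by (intro mult_left_mono) (auto intro: mult_left_le simp: add_nonneg_nonneg)
    finally show ?thesis .
  qed
  have diff: "norm (F (of_real k + of_real t) - F (of_real k)) \<le> sqrt (M / k)"
    if k: "k \<ge> 1" and t: "0 \<le> t" "t \<le> 1" for k t
  proof -
    \<comment> \<open>The derivative of \<open>G t\<close> at k is F (k + t) - F k. The unit disc
      around k stays in the strip, and k \<ge> 1 keeps it in the right half plane.\<close>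
    have "norm ((deriv ^^ 1) (G t) (of_real k)) \<le> fact 1 * sqrt (M / k) / 1 ^ 1"
    proof (rule Cauchy_inequality)
      show "G t holomorphic_on ball (of_real k) 1" using holG holomorphic_on_subset by blast
      show "continuous_on (cball (of_real k) 1) (G t)"
        using holG holomorphic_on_imp_continuous_on holomorphic_on_subset by blast
      fix x :: complex assume x: "norm (of_real k - x) = 1"
      have "Re x \<ge> k - 1" using complex_Re_le_cmod[of "of_real k - x"] x by simp
      moreover have "\<bar>Im x\<bar> \<le> 1" using abs_Im_le_cmod[of "of_real k - x"] x by simp
      ultimately have 1: "(norm (G t x))\<^sup>2 * norm (x + 1) \<le> M" using strip k t by auto
      have "k \<le> norm (x + 1)" using complex_Re_le_cmod[of "x + 1"] \<open>Re x \<ge> k - 1\<close> by simp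
      then have "(norm (G t x))\<^sup>2 * k \<le> (norm (G t x))\<^sup>2 * norm (x + 1)"
        by (intro mult_left_mono) auto
      then have "(norm (G t x))\<^sup>2 \<le> M / k" using 1 k by (simp add: field_simps)
      then show "norm (G t x) \<le> sqrt (M / k)" by (simp add: real_le_rsqrt)
    qed simp
    then show ?thesis using DERIV_imp_deriv[OF derG] by simp
  qed
  have bound: "norm (F (of_real k)) \<le> sqrt (M / k) + sqrt (c / (k + 1))" if k: "k \<ge> 1" for k
  proof -
    \<comment> \<open>\<open>G 1 k\<close> is the mean of F over [k, k + 1], small by
      \<open>realG\<close>. Its distance from F k is the mean of F u - F k, small by
      \<open>diff\<close>.\<close>
    have i1: "((\<lambda>u. F (of_real u) - F (of_real k)) has_integral (G 1 (of_real k) - F (of_real k))) {k..k+1}"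
      using has_integral_diff[OF intF[of 1 k] has_integral_const_real[of "F (of_real k)" k "k+1"]] by simp
    have "norm (G 1 (of_real k) - F (of_real k)) \<le> sqrt (M / k) * (k + 1 - k)"
    proof (rule has_integral_bound_real[OF _ _ i1, where S = "{}", THEN order_trans])
      show "0 \<le> sqrt (M / k)" using k M0 by simp
      fix u assume "u \<in> {k..k+1} - {}"
      then show "norm (F (of_real u) - F (of_real k)) \<le> sqrt (M / k)"
        using diff[OF k, of "u - k"] by auto
    qed (use M0 in auto)
    moreover have "norm (G 1 (of_real k)) \<le> sqrt (c / (k + 1))"
      using realG[of k 1] k by (simp add: real_le_rsqrt)
    ultimately show ?thesis
      using norm_triangle_ineq4[of "G 1 (of_real k)" "G 1 (of_real k) - F (of_real k)"] by simp
  qed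
  have "((\<lambda>k. sqrt (M / k) + sqrt (c / (k + 1))) \<longlongrightarrow> 0) at_top"
    using M0 c by real_asymp
  then show ?thesis
    by (rule Lim_null_comparison[rotated]) (use bound in \<open>auto simp: eventually_at_top_linorder\<close>)
qed

section \<open>Fourier integrals\<close>

text \<open>Dominated convergence for the remainder \<open>q\<close> of the difference quotient. The
  first order bound on exp (i k t) - 1 gives the majorant 2 |k h(k)|, uniform in t, and the second
  order bound gives pointwise convergence to 0.\<close>

lemma has_vector_derivative_fourier_integral:
  fixes h :: "real \<Rightarrow> complex"
  assumes h: "integrable lborel h" and kh: "integrable lborel (\<lambda>k. of_real k * h k)"
  shows "((\<lambda>y. LINT k|lborel. h k * exp (\<i> * of_real (k * y))) has_vector_derivative
           (LINT k|lborel. \<i> * of_real k * h k * exp (\<i> * of_real (k * y)))) (at y)"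
proof -
  define f where "f = (\<lambda>y. LINT k|lborel. h k * exp (\<i> * of_real (k * y)))"
  define D where "D = (LINT k|lborel. \<i> * of_real k * h k * exp (\<i> * of_real (k * y)))"
  have hm[measurable]: "h \<in> borel_measurable borel" using h by simp
  have i1: "integrable lborel (\<lambda>k. h k * exp (\<i> * of_real (k * y)))" for y
    by (rule Bochner_Integration.integrable_bound[OF h]) (auto simp: norm_mult)
  have i2: "integrable lborel (\<lambda>k. \<i> * of_real k * h k * exp (\<i> * of_real (k * y)))"
    by (rule Bochner_Integration.integrable_bound[OF kh]) (auto simp: norm_mult)
  define q where "q = (\<lambda>t k. h k * exp (\<i> * of_real (k * y)) *
    (exp (\<i> * of_real (k * t)) - 1 - \<i> * of_real (k * t)) / of_real t)"
  have qm[measurable]: "q t \<in> borel_measurable borel" for t unfolding q_def by measurable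
  have qb: "norm (q t k) \<le> 2 * norm (of_real k * h k)" if "t \<noteq> 0" for t k
  proof -
    have "norm (exp (\<i> * of_real (k * t)) - 1) \<le> \<bar>k * t\<bar>"
      using iexp_approx1[of "k * t" 0] by simp
    moreover have "norm (\<i> * complex_of_real (k * t)) = \<bar>k * t\<bar>" by (simp add: norm_mult abs_mult)
    ultimately have "norm (exp (\<i> * of_real (k * t)) - 1 - \<i> * of_real (k * t)) \<le> 2 * \<bar>k * t\<bar>"
      using norm_triangle_ineq4[of "exp (\<i> * of_real (k * t)) - 1" "\<i> * of_real (k * t)"] by linarith
    then have "norm (h k) * norm (exp (\<i> * of_real (k * t)) - 1 - \<i> * of_real (k * t)) / \<bar>t\<bar>
        \<le> norm (h k) * (2 * \<bar>k * t\<bar>) / \<bar>t\<bar>"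
      by (intro divide_right_mono mult_left_mono) auto
    also have "\<dots> = 2 * norm (of_real k * h k)" using that by (simp add: norm_mult abs_mult)
    finally show ?thesis by (simp add: q_def norm_mult norm_divide)
  qed
  have qs: "norm (q t k) \<le> norm (h k) * k\<^sup>2 / 2 * \<bar>t\<bar>" for t k
  proof (cases "t = 0")
    case False
    have "norm (exp (\<i> * of_real (k * t)) - 1 - \<i> * of_real (k * t)) \<le> (k * t)\<^sup>2 / 2"
      using iexp_approx1[of "k * t" 1] by (simp add: algebra_simps power2_eq_square)
    then have "norm (h k) * norm (exp (\<i> * of_real (k * t)) - 1 - \<i> * of_real (k * t)) / \<bar>t\<bar>
        \<le> norm (h k) * ((k * t)\<^sup>2 / 2) / \<bar>t\<bar>"
      by (intro divide_right_mono mult_left_mono) auto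
    also have "\<dots> = norm (h k) * k\<^sup>2 / 2 * (t\<^sup>2 / \<bar>t\<bar>)" by (simp add: power_mult_distrib)
    also have "t\<^sup>2 / \<bar>t\<bar> = \<bar>t\<bar>" using False by (simp add: power2_eq_square abs_if)
    finally show ?thesis by (simp add: q_def norm_mult norm_divide)
  qed (simp add: q_def)
  have eq: "norm (f (y + t) - f y - t *\<^sub>R D) / norm t = norm (LINT k|lborel. q t k)" if t: "t \<noteq> 0" for t
  proof -
    have "f (y + t) - f y - t *\<^sub>R D = (LINT k|lborel. h k * exp (\<i> * of_real (k * (y + t))) - h k * exp (\<i> * of_real (k * y))
       - of_real t * (\<i> * of_real k * h k * exp (\<i> * of_real (k * y))))"
      unfolding f_def D_def
      by (simp only: scaleR_conv_of_real Bochner_Integration.integral_diff[OF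
            Bochner_Integration.integrable_diff[OF i1 i1] integrable_mult_right[OF i2]]
          Bochner_Integration.integral_diff[OF i1 i1] integral_mult_right_zero)
    also have "\<dots> = (LINT k|lborel. of_real t * q t k)"
    proof (rule Bochner_Integration.integral_cong[OF refl])
      fix k
      have "exp (\<i> * of_real (k * (y + t))) = exp (\<i> * of_real (k * y)) * exp (\<i> * complex_of_real (k * t))"
        by (simp add: exp_add[symmetric] ring_distribs)
      moreover have "of_real t * q t k = h k * exp (\<i> * of_real (k * y)) *
          (exp (\<i> * of_real (k * t)) - 1 - \<i> * of_real (k * t))"
        using t by (simp add: q_def)
      ultimately show "h k * exp (\<i> * of_real (k * (y + t))) - h k * exp (\<i> * of_real (k * y))
         - of_real t * (\<i> * of_real k * h k * exp (\<i> * of_real (k * y))) = of_real t * q t k"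
        by (simp only:) (simp add: algebra_simps)
    qed
    also have "\<dots> = of_real t * (LINT k|lborel. q t k)" by simp
    finally show ?thesis using t by (simp add: norm_mult)
  qed
  have "((\<lambda>t. norm (f (y + t) - f y - t *\<^sub>R D) / norm t) \<longlongrightarrow> 0) (at 0)"
    unfolding tendsto_at_iff_sequentially
  proof (intro allI impI)
    fix X :: "nat \<Rightarrow> real" assume X: "\<forall>i. X i \<in> UNIV - {0}" "X \<longlonglongrightarrow> 0"
    have "(\<lambda>i. LINT k|lborel. q (X i) k) \<longlonglongrightarrow> (LINT (k::real)|lborel. 0)"
    proof (rule integral_dominated_convergence)
      show "integrable lborel (\<lambda>k. 2 * norm (of_real k * h k))" using kh by simp
      show "AE k in lborel. (\<lambda>i. q (X i) k) \<longlonglongrightarrow> 0"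
      proof (rule AE_I2)
        fix k
        have "(\<lambda>i. norm (h k) * k\<^sup>2 / 2 * \<bar>X i\<bar>) \<longlonglongrightarrow> norm (h k) * k\<^sup>2 / 2 * \<bar>0\<bar>"
          by (intro tendsto_intros X)
        then have "(\<lambda>i. norm (h k) * k\<^sup>2 / 2 * \<bar>X i\<bar>) \<longlonglongrightarrow> 0" by simp
        then show "(\<lambda>i. q (X i) k) \<longlonglongrightarrow> 0"
          by (rule Lim_null_comparison[rotated]) (intro always_eventually allI qs)
      qed
    qed (use X qb in auto)
    then have "(\<lambda>i. norm (LINT k|lborel. q (X i) k)) \<longlonglongrightarrow> 0"
      by (simp add: tendsto_norm_zero)
    then show "((\<lambda>t. norm (f (y + t) - f y - t *\<^sub>R D) / norm t) \<circ> X) \<longlonglongrightarrow> 0"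
      using X eq by (simp add: o_def)
  qed
  then have "(f has_vector_derivative D) (at y)"
    unfolding has_vector_derivative_def has_derivative_at by (simp add: bounded_linear_scaleR_left)
  then show ?thesis by (simp add: f_def D_def)
qed

section \<open>Fubini with a bounded kernel, and half of Plancherel's identity\<close>

lemma (in finite_measure) integral_swap_bounded:
  fixes g :: "real \<Rightarrow> complex" and b :: "real \<Rightarrow> 'a \<Rightarrow> complex"
  assumes g: "integrable lborel g"
    and b: "case_prod b \<in> borel_measurable (lborel \<Otimes>\<^sub>M M)" "\<And>k x. norm (b k x) \<le> B"
  shows "(LINT x|M. LINT k|lborel. g k * b k x) = (LINT k|lborel. g k * (LINT x|M. b k x))"
proof -
  interpret P: pair_sigma_finite lborel M ..
  have gm[measurable]: "g \<in> borel_measurable borel" using g by simp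
  note b(1)[measurable]
  have bm: "b k \<in> borel_measurable M" for k
    using measurable_compose[OF measurable_Pair1' b(1), of k] by simp
  have ib: "integrable M (b k)" for k
    by (rule integrable_const_bound[of _ B]) (use bm b in auto)
  have "integrable (lborel \<Otimes>\<^sub>M M) (\<lambda>(k, x). g k * b k x)"
  proof (rule P.Fubini_integrable)
    show m: "(\<lambda>(k, x). g k * b k x) \<in> borel_measurable (lborel \<Otimes>\<^sub>M M)" by measurable
    show "AE k in lborel. integrable M (\<lambda>x. case (k, x) of (k, x) \<Rightarrow> g k * b k x)" using ib by simp
    have le: "norm (LINT x|M. norm (case (k, x) of (k, x) \<Rightarrow> g k * b k x)) \<le> norm (g k * of_real (B * measure M (space M)))" for k
    proof -
      have "norm (LINT x|M. norm (case (k, x) of (k, x) \<Rightarrow> g k * b k x)) = norm (g k) * (LINT x|M. norm (b k x))"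
        by (simp add: norm_mult)
      also have "\<dots> \<le> norm (g k) * (LINT x|M. B)"
        using ib b(2) by (intro mult_left_mono integral_mono) auto
      also have "(LINT x|M. B) = B * measure M (space M)" by simp
      also have "norm (g k) * \<dots> \<le> norm (g k * of_real (B * measure M (space M)))"
        unfolding norm_mult norm_of_real abs_mult by (intro mult_left_mono mult_mono) auto
      finally show ?thesis .
    qed
    show "integrable lborel (\<lambda>k. LINT x|M. norm (case (k, x) of (k, x) \<Rightarrow> g k * b k x))"
      by (rule Bochner_Integration.integrable_bound[of _ "\<lambda>k. g k * of_real (B * measure M (space M))"])
        (use g le in auto)
  qed
  then have "integrable (lborel \<Otimes>\<^sub>M M) (\<lambda>(k, x). (\<lambda>k x. g k * b k x) k x)" .
  from P.Fubini_integral[OF this] show ?thesis by simp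
qed


text \<open>Only this half of Plancherel's identity is needed. The integral of \<open>\<bar>G\<bar>\<^sup>2\<close> is compared with the
  expectation of \<open>\<bar>G (Z / s)\<bar>\<^sup>2\<close> for a standard normal \<open>Z\<close>, whose characteristic function turns it
  into \<open>g\<close> integrated against its own Gaussian mollification at scale \<open>s\<close>.\<close>
lemma fourier_integral_L2_lower_bound:
  fixes g :: "real \<Rightarrow> complex"
  assumes g: "integrable lborel g" and bnd: "\<And>k. norm (g k) \<le> B"
    and cont: "AE k in lborel. isCont g k"
  shows "ennreal (2 * pi * (LINT k|lborel. (norm (g k))\<^sup>2))
      \<le> (\<integral>\<^sup>+ y. ennreal ((norm (LINT k|lborel. g k * exp (\<i> * of_real (k * y))))\<^sup>2) \<partial>lborel)"
proof -
  let ?N = std_normal_distribution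
  interpret N: prob_space ?N by (rule prob_space_normal_density) simp
  have gm[measurable]: "g \<in> borel_measurable borel" using g by simp
  have cnj_m[measurable]: "cnj \<in> borel_measurable borel"
    by (intro borel_measurable_continuous_onI continuous_intros)
  define G where "G = (\<lambda>y. LINT k|lborel. g k * exp (\<i> * of_real (k * y)))"
  define A where "A = (LINT k|lborel. norm (g k))"
  have Gm[measurable]: "G \<in> borel_measurable borel" unfolding G_def by measurable
  have GA: "norm (G y) \<le> A" for y
  proof -
    have "norm (G y) \<le> (LINT k|lborel. norm (g k * exp (\<i> * of_real (k * y))))"
      unfolding G_def by (rule integral_norm_bound)
    then show ?thesis by (simp add: A_def norm_mult)
  qed
  have gb: "integrable ?N (\<lambda>u. cnj (g (k + s * u)))" for k s
    by (rule N.integrable_const_bound[of _ B]) (auto simp: bnd)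
  \<comment> \<open>\<open>L s\<close> is g integrated against the conjugate of its Gaussian average
    at scale s. \<open>E\<close> ties it to the expectation of |G (Z / s)|^2, and it tends to the
    integral of |g|^2 as s tends to 0.\<close>
  define L where "L = (\<lambda>s. LINT k|lborel. g k * (LINT u|?N. cnj (g (k + s * u))))"
  have E: "(LINT z|?N. G (z / s) * cnj (G (z / s))) = of_real (s * sqrt (2 * pi)) * L s" if s: "s > 0" for s
  proof -
    have "(LINT z|?N. G (z / s) * cnj (G (z / s)))
       = (LINT z|?N. LINT k|lborel. g k * (exp (\<i> * of_real (k * (z / s))) * cnj (G (z / s))))"
      unfolding G_def by (simp add: mult.assoc[symmetric] del: of_real_mult of_real_divide)
    also have "\<dots> = (LINT k|lborel. g k * (LINT z|?N. exp (\<i> * of_real (k * (z / s))) * cnj (G (z / s))))"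
    proof (rule N.integral_swap_bounded[OF g])
      show "(\<lambda>(k, z). exp (\<i> * of_real (k * (z / s))) * cnj (G (z / s))) \<in> borel_measurable (lborel \<Otimes>\<^sub>M ?N)"
        by measurable
      show "norm (exp (\<i> * of_real (k * (z / s))) * cnj (G (z / s))) \<le> A" for k z
        using GA by (simp add: norm_mult del: of_real_mult of_real_divide)
    qed
    also have "\<dots> = (LINT k|lborel. of_real (s * sqrt (2 * pi)) * (g k * (LINT u|?N. cnj (g (k + s * u)))))"
    proof (rule Bochner_Integration.integral_cong[OF refl])
      fix k :: real
      have "(LINT z|?N. exp (\<i> * of_real (k * (z / s))) * cnj (G (z / s)))
         = (LINT z|?N. LINT l|lborel. cnj (g l) * exp (\<i> * of_real ((k - l) / s * z)))"
      proof (rule Bochner_Integration.integral_cong[OF refl])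
        fix z :: real
        have "cnj (G (z / s)) = (LINT l|lborel. cnj (g l) * exp (- (\<i> * of_real (l * (z / s)))))"
          unfolding G_def Bochner_Integration.integral_cnj[symmetric] by (simp add: exp_cnj)
        then have "exp (\<i> * of_real (k * (z / s))) * cnj (G (z / s))
           = (LINT l|lborel. exp (\<i> * of_real (k * (z / s))) * (cnj (g l) * exp (- (\<i> * of_real (l * (z / s))))))"
          by simp
        also have "\<dots> = (LINT l|lborel. cnj (g l) * exp (\<i> * of_real ((k - l) / s * z)))"
          by (intro Bochner_Integration.integral_cong refl)
            (simp add: exp_add[symmetric] mult.left_commute diff_divide_distrib ring_distribs)
        finally show "exp (\<i> * of_real (k * (z / s))) * cnj (G (z / s))
           = (LINT l|lborel. cnj (g l) * exp (\<i> * of_real ((k - l) / s * z)))" .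
      qed
      also have "\<dots> = (LINT l|lborel. cnj (g l) * (LINT z|?N. exp (\<i> * of_real ((k - l) / s * z))))"
      proof (rule N.integral_swap_bounded)
        show "(\<lambda>(l, z). exp (\<i> * of_real ((k - l) / s * z))) \<in> borel_measurable (lborel \<Otimes>\<^sub>M ?N)"
          by measurable
        show "norm (exp (\<i> * of_real ((k - l) / s * z))) \<le> 1" for l z
          by (simp del: of_real_mult of_real_divide)
      qed (use g in simp)
      \<comment> \<open>The characteristic function of the normal law yields a Gaussian in (k - l) /
        s. The substitution l = k + s u then turns it into a multiple of the standard normal density
        in u.\<close>
      also have "\<dots> = (LINT l|lborel. cnj (g l) * of_real (exp (- ((k - l) / s)\<^sup>2 / 2)))"
      proof (rule Bochner_Integration.integral_cong[OF refl])
        fix l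
        show "cnj (g l) * (LINT z|?N. exp (\<i> * of_real ((k - l) / s * z)))
           = cnj (g l) * of_real (exp (- ((k - l) / s)\<^sup>2 / 2))"
          using fun_cong[OF char_std_normal_distribution, of "(k - l) / s"] unfolding char_def by simp
      qed
      also have "\<dots> = of_real s * (LINT u|lborel. cnj (g (k + s * u)) * of_real (exp (- u\<^sup>2 / 2)))"
        using s by (subst lborel_integral_real_affine[of s _ k]) (auto simp: scaleR_conv_of_real)
      also have "(LINT u|lborel. cnj (g (k + s * u)) * of_real (exp (- u\<^sup>2 / 2)))
         = of_real (sqrt (2 * pi)) * (LINT u|?N. cnj (g (k + s * u)))"
      proof -
        have "(LINT u|?N. cnj (g (k + s * u)))
           = (LINT u|lborel. std_normal_density u *\<^sub>R cnj (g (k + s * u)))"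
          by (rule integral_density) auto
        also have "\<dots> = (LINT u|lborel. of_real (1 / sqrt (2 * pi)) * (cnj (g (k + s * u)) * of_real (exp (- u\<^sup>2 / 2))))"
          by (intro Bochner_Integration.integral_cong refl)
            (simp add: std_normal_density_def scaleR_conv_of_real)
        also have "\<dots> = of_real (1 / sqrt (2 * pi)) * (LINT u|lborel. cnj (g (k + s * u)) * of_real (exp (- u\<^sup>2 / 2)))"
          by (rule integral_mult_right_zero)
        finally show ?thesis by simp
      qed
      finally show "g k * (LINT z|?N. exp (\<i> * of_real (k * (z / s))) * cnj (G (z / s)))
         = of_real (s * sqrt (2 * pi)) * (g k * (LINT u|?N. cnj (g (k + s * u))))"
        by (simp add: mult_ac)
    qed
    also have "\<dots> = of_real (s * sqrt (2 * pi)) * L s" by (simp add: L_def)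
    finally show ?thesis .
  qed
  have low: "ennreal (2 * pi * Re (L s)) \<le> (\<integral>\<^sup>+ y. ennreal ((norm (G y))\<^sup>2) \<partial>lborel)" if s: "s > 0" for s
  proof -
    define e where "e = (LINT z|?N. (norm (G (z / s)))\<^sup>2)"
    have "complex_of_real e = (LINT z|?N. G (z / s) * cnj (G (z / s)))"
      unfolding e_def complex_norm_square[symmetric] by (simp add: integral_complex_of_real[symmetric] complex_norm_square)
    then have "complex_of_real e = of_real (s * sqrt (2 * pi)) * L s" using E[OF s] by simp
    from arg_cong[OF this, of Re] have e: "e = s * sqrt (2 * pi) * Re (L s)"
      by (simp del: of_real_mult)
    have "ennreal e = (\<integral>\<^sup>+ z. ennreal ((norm (G (z / s)))\<^sup>2) \<partial>?N)"
      unfolding e_def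
    proof (rule nn_integral_eq_integral[symmetric])
      show "integrable ?N (\<lambda>z. (norm (G (z / s)))\<^sup>2)"
        by (rule N.integrable_const_bound[of _ "A\<^sup>2"]) (auto intro!: power_mono GA)
    qed simp
    also have "\<dots> = (\<integral>\<^sup>+ z. ennreal (std_normal_density z) * ennreal ((norm (G (z / s)))\<^sup>2) \<partial>lborel)"
      by (rule nn_integral_density) measurable
    \<comment> \<open>The density is replaced by its maximum 1 / sqrt (2 pi). This is the only loss,
      and it removes s from the right-hand side after rescaling y = z / s.\<close>
    also have "\<dots> \<le> (\<integral>\<^sup>+ z. ennreal (1 / sqrt (2 * pi)) * ennreal ((norm (G (z / s)))\<^sup>2) \<partial>lborel)"
      by (intro nn_integral_mono mult_right_mono ennreal_leI)
        (auto simp: std_normal_density_def divide_right_mono)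
    also have "\<dots> = ennreal (1 / sqrt (2 * pi)) * (\<integral>\<^sup>+ z. ennreal ((norm (G (z / s)))\<^sup>2) \<partial>lborel)"
      by (rule nn_integral_cmult) measurable
    finally have 1: "ennreal e \<le> ennreal (1 / sqrt (2 * pi)) * (\<integral>\<^sup>+ z. ennreal ((norm (G (z / s)))\<^sup>2) \<partial>lborel)" .
    have "ennreal (2 * pi * Re (L s)) = ennreal (sqrt (2 * pi) / s * e)"
      using s by (simp add: e) (simp add: mult.assoc[symmetric])
    also have "\<dots> = ennreal (sqrt (2 * pi) / s) * ennreal e"
      using s by (intro ennreal_mult'') (simp add: e_def)
    also have "\<dots> \<le> ennreal (sqrt (2 * pi) / s) * (ennreal (1 / sqrt (2 * pi)) * (\<integral>\<^sup>+ z. ennreal ((norm (G (z / s)))\<^sup>2) \<partial>lborel))"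
      using 1 by (rule mult_left_mono) simp
    also have "\<dots> = ennreal (1 / s) * (\<integral>\<^sup>+ z. ennreal ((norm (G (z / s)))\<^sup>2) \<partial>lborel)"
      using s by (simp add: mult.assoc[symmetric] ennreal_mult[symmetric])
    also have "\<dots> = (\<integral>\<^sup>+ y. ennreal ((norm (G y))\<^sup>2) \<partial>lborel)"
      using s by (subst (2) nn_integral_real_affine[where c = "1 / s" and t = 0]) auto
    finally show ?thesis .
  qed
  define X where "X = (\<lambda>n::nat. 1 / (real n + 1))"
  have X: "X \<longlonglongrightarrow> 0" "X n > 0" for n
    using LIMSEQ_inverse_real_of_nat by (auto simp: X_def inverse_eq_divide add.commute)
  have "(\<lambda>n. L (X n)) \<longlonglongrightarrow> (LINT k|lborel. g k * cnj (g k))"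
    unfolding L_def
  proof (rule integral_dominated_convergence)
    show "integrable lborel (\<lambda>k. norm (g k) * B)" using g by simp
    \<comment> \<open>At a point of continuity the values g (k + X n * u) converge to g k for every
      u, with the constant \<open>B\<close> as majorant.\<close>
    show "AE k in lborel. (\<lambda>n. g k * (LINT u|?N. cnj (g (k + X n * u)))) \<longlonglongrightarrow> g k * cnj (g k)"
      using cont
    proof eventually_elim
      case (elim k)
      have "(\<lambda>n. LINT u|?N. cnj (g (k + X n * u))) \<longlonglongrightarrow> (LINT u|?N. cnj (g k))"
      proof (rule integral_dominated_convergence[where w = "\<lambda>_. B"])
        show "AE u in ?N. (\<lambda>n. cnj (g (k + X n * u))) \<longlonglongrightarrow> cnj (g k)"
        proof (rule AE_I2)
          fix u
          have "(\<lambda>n. k + X n * u) \<longlonglongrightarrow> k + 0 * u" by (intro tendsto_intros X)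
          then have "(\<lambda>n. g (k + X n * u)) \<longlonglongrightarrow> g k"
            using elim isCont_tendsto_compose by fastforce
          then show "(\<lambda>n. cnj (g (k + X n * u))) \<longlonglongrightarrow> cnj (g k)" by (rule tendsto_cnj)
        qed
      qed (auto simp: bnd)
      also have "(LINT u|?N. cnj (g k)) = cnj (g k)" using N.prob_space by simp
      finally show ?case by (intro tendsto_intros)
    qed
    show "AE k in lborel. norm (g k * (LINT u|?N. cnj (g (k + X n * u)))) \<le> norm (g k) * B" for n
    proof (rule AE_I2)
      fix k
      have "norm (LINT u|?N. cnj (g (k + X n * u))) \<le> (LINT u|?N. norm (cnj (g (k + X n * u))))"
        by (rule integral_norm_bound)
      also have "\<dots> \<le> (LINT u|?N. B)" using gb[of k "X n"] bnd by (intro integral_mono) auto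
      also have "\<dots> = B" using N.prob_space by simp
      finally show "norm (g k * (LINT u|?N. cnj (g (k + X n * u)))) \<le> norm (g k) * B"
        by (simp add: norm_mult mult_left_mono)
    qed
  qed measurable
  also have "(LINT k|lborel. g k * cnj (g k)) = of_real (LINT k|lborel. (norm (g k))\<^sup>2)"
    unfolding integral_complex_of_real[symmetric] by (simp only: complex_norm_square)
  finally have "(\<lambda>n. ennreal (2 * pi * Re (L (X n)))) \<longlonglongrightarrow> ennreal (2 * pi * Re (of_real (LINT k|lborel. (norm (g k))\<^sup>2)))"
    by (intro tendsto_intros)
  then have "ennreal (2 * pi * (LINT k|lborel. (norm (g k))\<^sup>2)) \<le> (\<integral>\<^sup>+ y. ennreal ((norm (G y))\<^sup>2) \<partial>lborel)"
    unfolding Re_complex_of_real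
    by (rule LIMSEQ_le_const2) (use low X in auto)
  then show ?thesis by (simp add: G_def)
qed

section \<open>The source term\<close>

definition plane_pt :: "real \<times> real \<Rightarrow> complex" where
  "plane_pt p = of_real (fst p) + \<i> * of_real (snd p)"

text \<open>At real z = k the kernel is exp (-k x) exp (-i k y), so \<open>I_k\<close> is, for k
  \<ge> 0, the restriction of this function to the half line. Compact support of the charge makes it
  entire and of exponential type.\<close>

definition laplace :: "(real \<times> real \<Rightarrow> real) \<Rightarrow> complex \<Rightarrow> complex" where
  "laplace rho z = (LINT p|lborel. of_real (rho p) * exp (- z * plane_pt p))"

lemma plane_pt_measurable[measurable]: "plane_pt \<in> borel_measurable borel"
  unfolding plane_pt_def by (intro borel_measurable_continuous_onI continuous_intros)

lemma norm_plane_pt_le: "norm (plane_pt p) \<le> 2 * norm p"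
proof -
  have "norm (plane_pt p) \<le> \<bar>fst p\<bar> + \<bar>snd p\<bar>"
    unfolding plane_pt_def using norm_triangle_ineq[of "of_real (fst p)" "\<i> * of_real (snd p)"]
    by (simp add: norm_mult)
  also have "\<dots> \<le> norm p + norm p"
    by (intro add_mono) (use norm_fst_le[of "fst p" "snd p"] norm_snd_le[of "snd p" "fst p"] in auto)
  finally show ?thesis by simp
qed

lemma P_class_support:
  assumes "rho \<in> P_class a"
  shows "a < d0 rho" and "rho p \<noteq> 0 \<Longrightarrow> d0 rho \<le> fst p \<and> fst p \<le> d1 rho"
    and "\<exists>R>0. \<forall>p. rho p \<noteq> 0 \<longrightarrow> norm p \<le> R"
proof -
  have K: "compact (supp rho)" "supp rho \<subseteq> {p. a < fst p}" "0 < emeasure lborel (supp rho)"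
    using assms by (auto simp: P_class_def)
  have ne: "fst ` supp rho \<noteq> {}" using K(3) by auto
  have cp: "compact (fst ` supp rho)" by (intro compact_continuous_image K continuous_intros)
  have "d0 rho \<in> fst ` supp rho" unfolding d0_def
    by (rule closed_contains_Inf[OF ne]) (use cp in \<open>auto simp: compact_imp_closed compact_imp_bounded bounded_imp_bdd_below\<close>)
  then show "a < d0 rho" using K by auto
  have sub: "rho p \<noteq> 0 \<Longrightarrow> p \<in> supp rho" for p
    unfolding supp_def using closure_subset[of "{p. rho p \<noteq> 0}"] by auto
  show "rho p \<noteq> 0 \<Longrightarrow> d0 rho \<le> fst p \<and> fst p \<le> d1 rho"
    unfolding d0_def d1_def using sub[of p] cp
    by (auto intro!: cInf_lower cSup_upper simp: compact_imp_bounded bounded_imp_bdd_below bounded_imp_bdd_above)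
  obtain R where "R > 0" "\<forall>x\<in>supp rho. norm x \<le> R"
    using K(1) compact_imp_bounded bounded_pos by metis
  then show "\<exists>R>0. \<forall>p. rho p \<noteq> 0 \<longrightarrow> norm p \<le> R" using sub by blast
qed

lemma P_class_integrable:
  assumes "rho \<in> P_class a"
  shows "integrable lborel rho" and "(LINT p|lborel. rho p) = 0"
proof -
  have m: "rho \<in> borel_measurable lborel" and K: "compact (supp rho)" "emeasure lborel (supp rho) < \<infinity>"
    and z: "(LINT x|lborel. LINT y|lborel. rho (x, y)) = 0"
    using assms by (auto simp: P_class_def)
  obtain B where B: "AE p in lborel. \<bar>rho p\<bar> \<le> B" using assms by (auto simp: P_class_def)
  have sub: "rho p \<noteq> 0 \<Longrightarrow> p \<in> supp rho" for p
    unfolding supp_def using closure_subset[of "{p. rho p \<noteq> 0}"] by auto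
  show i: "integrable lborel rho"
  proof (rule Bochner_Integration.integrable_bound)
    have "supp rho \<in> sets lborel" using K(1) by (simp add: borel_compact)
    then show "integrable lborel (\<lambda>p. B * indicator (supp rho) p :: real)"
      using K(2) by (intro integrable_mult_right integrable_real_indicator) auto
    show "AE p in lborel. norm (rho p) \<le> norm (B * indicator (supp rho) p :: real)"
      using B sub by (auto simp: indicator_def elim!: eventually_mono)
  qed (rule m)
  then have "integrable (lborel \<Otimes>\<^sub>M lborel) rho" by (simp add: lborel_prod)
  from lborel_pair.integral_fst'[OF this] z show "(LINT p|lborel. rho p) = 0"
    by (simp add: lborel_prod)
qed

lemma integrable_times_bounded_on_support:
  fixes f :: "real \<times> real \<Rightarrow> complex"
  assumes rho: "integrable lborel rho" and f: "f \<in> borel_measurable borel"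
    and b: "\<And>p. rho p \<noteq> 0 \<Longrightarrow> norm (f p) \<le> B"
  shows "integrable lborel (\<lambda>p. of_real (rho p) * f p)"
    and "norm (LINT p|lborel. of_real (rho p) * f p) \<le> (LINT p|lborel. \<bar>rho p\<bar>) * B"
proof -
  have [measurable]: "rho \<in> borel_measurable borel" using rho by simp
  note f[measurable]
  have le: "norm (of_real (rho p) * f p) \<le> norm (\<bar>rho p\<bar> * B)" for p
    using b[of p] by (cases "rho p = 0") (auto simp: norm_mult abs_mult intro!: mult_left_mono)
  show i: "integrable lborel (\<lambda>p. of_real (rho p) * f p)"
    by (rule Bochner_Integration.integrable_bound[of _ "\<lambda>p. \<bar>rho p\<bar> * B"]) (use rho le in auto)
  have le': "norm (of_real (rho p) * f p) \<le> \<bar>rho p\<bar> * B" for p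
    using b[of p] by (cases "rho p = 0") (auto simp: norm_mult intro!: mult_left_mono)
  have "norm (LINT p|lborel. of_real (rho p) * f p) \<le> (LINT p|lborel. norm (of_real (rho p) * f p))"
    by (rule integral_norm_bound)
  also have "\<dots> \<le> (LINT p|lborel. \<bar>rho p\<bar> * B)"
    using i rho le' by (intro integral_mono) auto
  finally show "norm (LINT p|lborel. of_real (rho p) * f p) \<le> (LINT p|lborel. \<bar>rho p\<bar>) * B" by simp
qed

text \<open>Mean value inequality on the convex left half plane, where |exp| \<le> 1.\<close>

lemma norm_exp_minus_1_le:
  assumes "Re w \<le> 0"
  shows "norm (exp w - 1) \<le> norm w"
proof -
  have "norm (exp w - exp 0) \<le> 1 * norm (w - 0)"
    by (rule field_differentiable_bound[where S = "{z. Re z \<le> 0}" and f' = exp])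
      (use assms in \<open>auto intro!: derivative_eq_intros convex_halfspace_Re_le simp: \<close>)
  then show ?thesis by simp
qed

text \<open>Fubini. Restricting the outer integral to [d0, d1] loses nothing, since the charge
  vanishes for all other abscissae.\<close>

lemma I_k_eq_integral:
  assumes rho: "rho \<in> P_class a" and a: "a > 0"
  shows "I_k rho k = (LINT p|lborel. of_real (rho p) * exp (- of_real (\<bar>k\<bar> * fst p) - \<i> * of_real (k * snd p)))"
proof -
  define h where "h = (\<lambda>p. of_real (rho p) * exp (- complex_of_real (\<bar>k\<bar> * fst p) - \<i> * of_real (k * snd p)))"
  have "integrable lborel h" unfolding h_def
  proof (rule integrable_times_bounded_on_support(1)[OF P_class_integrable(1)[OF rho], where B = 1])
    show "(\<lambda>p. exp (- complex_of_real (\<bar>k\<bar> * fst p) - \<i> * of_real (k * snd p))) \<in> borel_measurable borel"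
      by (intro borel_measurable_continuous_onI continuous_intros)
    fix p :: "real \<times> real" assume "rho p \<noteq> 0"
    then have "fst p > 0" using P_class_support(1)[OF rho] P_class_support(2)[OF rho, of p] a by simp
    then show "norm (exp (- complex_of_real (\<bar>k\<bar> * fst p) - \<i> * of_real (k * snd p))) \<le> 1"
      by simp
  qed
  then have i: "integrable (lborel \<Otimes>\<^sub>M lborel) h" by (simp add: lborel_prod)
  have "I_k rho k = (LINT s|lborel. LINT y|lborel. h (s, y))"
    unfolding I_k_def set_lebesgue_integral_def
  proof (rule Bochner_Integration.integral_cong[OF refl])
    fix s :: real
    have "rho_hat rho s k * of_real (exp (- \<bar>k\<bar> * s)) = (LINT y|lborel. h (s, y))"
    proof -
      have "rho_hat rho s k * of_real (exp (- \<bar>k\<bar> * s)) = (LINT y|lborel. of_real (rho (s, y)) * exp (- \<i> * of_real (k * y)) * of_real (exp (- \<bar>k\<bar> * s)))"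
        unfolding rho_hat_def by simp
      also have "\<dots> = (LINT y|lborel. h (s, y))"
        unfolding h_def
        by (intro Bochner_Integration.integral_cong refl)
          (simp add: exp_of_real[symmetric] mult.assoc exp_add[symmetric] algebra_simps)
      finally show ?thesis .
    qed
    moreover have "(LINT y|lborel. h (s, y)) = 0" if "s \<notin> {d0 rho..d1 rho}"
    proof -
      have "h (s, y) = 0" for y
        using P_class_support(2)[OF rho, of "(s, y)"] that by (auto simp: h_def)
      then show ?thesis by simp
    qed
    ultimately show "indicator {d0 rho..d1 rho} s *\<^sub>R (rho_hat rho s k * of_real (exp (- \<bar>k\<bar> * s))) = (LINT y|lborel. h (s, y))"
      by (auto simp: indicator_def)
  qed
  also have "\<dots> = (LINT p|lborel. h p)"
    using lborel_pair.integral_fst'[OF i] by (simp add: lborel_prod)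
  finally show ?thesis by (simp add: h_def)
qed

text \<open>Since \<open>rho\<close> is real, negative frequencies give conjugates, so one entire
  function describes \<open>I_k\<close> on both half lines.\<close>

lemma I_k_eq_laplace:
  assumes rho: "rho \<in> P_class a" and a: "a > 0"
  shows "k \<ge> 0 \<Longrightarrow> I_k rho k = laplace rho (of_real k)"
    and "k \<le> 0 \<Longrightarrow> I_k rho k = cnj (laplace rho (of_real (- k)))"
proof -
  show "k \<ge> 0 \<Longrightarrow> I_k rho k = laplace rho (of_real k)"
    unfolding I_k_eq_integral[OF assms] laplace_def
    by (intro Bochner_Integration.integral_cong refl) (simp add: plane_pt_def algebra_simps)
  show "k \<le> 0 \<Longrightarrow> I_k rho k = cnj (laplace rho (of_real (- k)))"
    unfolding I_k_eq_integral[OF assms] laplace_def Bochner_Integration.integral_cnj[symmetric]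
    by (intro Bochner_Integration.integral_cong refl)
      (simp add: plane_pt_def exp_cnj algebra_simps)
qed

text \<open>The decay reflects that the support starts at \<open>d0 rho\<close>. The linear bound
  reflects that the total charge is 0; near k = 0 it compensates the factor 1/|k| in
  \<open>V_hat\<close>.\<close>

lemma I_k_bounds:
  assumes rho: "rho \<in> P_class a" and a: "a > 0"
  shows "\<exists>C\<ge>0. \<forall>k. norm (I_k rho k) \<le> C * exp (- \<bar>k\<bar> * d0 rho) \<and> norm (I_k rho k) \<le> C * \<bar>k\<bar>"
proof -
  obtain R where R: "R > 0" "\<And>p. rho p \<noteq> 0 \<Longrightarrow> norm p \<le> R" using P_class_support(3)[OF rho] by blast
  define A where "A = (LINT p|lborel. \<bar>rho p\<bar>)"
  note i = P_class_integrable[OF rho]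
  have [measurable]: "rho \<in> borel_measurable borel" using i(1) by simp
  have A: "A \<ge> 0" by (simp add: A_def)
  have pos: "d0 rho \<le> fst p" "fst p > 0" if "rho p \<noteq> 0" for p
    using P_class_support(1)[OF rho] P_class_support(2)[OF rho, of p] a that by simp_all
  have wm: "(\<lambda>p. exp (- complex_of_real (\<bar>k\<bar> * fst p) - \<i> * of_real (k * snd p))) \<in> borel_measurable borel" for k
    by (intro borel_measurable_continuous_onI continuous_intros)
  let ?w = "\<lambda>k p. - complex_of_real (\<bar>k\<bar> * fst p) - \<i> * of_real (k * snd p)"
  have 1: "norm (I_k rho k) \<le> A * exp (- \<bar>k\<bar> * d0 rho)" for k
    unfolding I_k_eq_integral[OF assms] A_def
  proof (rule integrable_times_bounded_on_support(2)[OF i(1)])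
    fix p assume "rho p \<noteq> 0"
    then show "norm (exp (?w k p)) \<le> exp (- \<bar>k\<bar> * d0 rho)"
      using pos[of p] by (simp add: mult_left_mono)
  qed (rule wm)
  have 2: "norm (I_k rho k) \<le> A * (2 * R * \<bar>k\<bar>)" for k
  proof -
    have b: "norm (exp (?w k p) - 1) \<le> 2 * R * \<bar>k\<bar>" if "rho p \<noteq> 0" for p
    proof -
      have "norm (exp (?w k p) - 1) \<le> norm (?w k p)"
        using pos[OF that] by (intro norm_exp_minus_1_le) simp
      also have "\<dots> \<le> \<bar>k\<bar> * \<bar>fst p\<bar> + \<bar>k\<bar> * \<bar>snd p\<bar>"
        using norm_triangle_ineq4[of "- complex_of_real (\<bar>k\<bar> * fst p)" "\<i> * of_real (k * snd p)"]
        by (simp add: norm_mult abs_mult)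
      also have "\<dots> \<le> \<bar>k\<bar> * R + \<bar>k\<bar> * R"
        using R(2)[OF that] norm_fst_le[of "fst p" "snd p"] norm_snd_le[of "snd p" "fst p"]
        by (intro add_mono mult_left_mono) auto
      finally show ?thesis by (simp add: algebra_simps)
    qed
    have e: "norm (exp (?w k p)) \<le> 1" if "rho p \<noteq> 0" for p using pos[OF that] by simp
    \<comment> \<open>Neutrality allows the integral of \<open>rho\<close> to be subtracted, which
      replaces the kernel by exp - 1.\<close>
    have "I_k rho k = (LINT p|lborel. of_real (rho p) * exp (?w k p)) - (LINT p|lborel. of_real (rho p) * 1)"
      unfolding I_k_eq_integral[OF assms] using i(2) by simp
    also have "\<dots> = (LINT p|lborel. of_real (rho p) * exp (?w k p) - of_real (rho p) * 1)"
      by (intro Bochner_Integration.integral_diff[symmetric] integrable_times_bounded_on_support(1)[OF i(1), where B = 1])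
        (use e wm in auto)
    also have "\<dots> = (LINT p|lborel. of_real (rho p) * (exp (?w k p) - 1))" by (simp add: right_diff_distrib)
    also have "norm \<dots> \<le> A * (2 * R * \<bar>k\<bar>)"
      unfolding A_def by (rule integrable_times_bounded_on_support(2)[OF i(1)]) (use b wm in auto)
    finally show ?thesis .
  qed
  have "A * exp (- \<bar>k\<bar> * d0 rho) \<le> (A + 2 * A * R) * exp (- \<bar>k\<bar> * d0 rho)"
    "A * (2 * R * \<bar>k\<bar>) \<le> (A + 2 * A * R) * \<bar>k\<bar>" for k
    using A R by (auto simp: algebra_simps)
  then show ?thesis using order_trans[OF 1] order_trans[OF 2] A R
    by (intro exI[of _ "A + 2 * A * R"] conjI allI) auto
qed

section \<open>The entire extension of \<open>I_k\<close>\<close>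

lemma laplace_growth:
  assumes rho: "rho \<in> P_class a"
  shows "\<exists>A\<ge>0. \<exists>r\<ge>0. \<forall>z. norm (laplace rho z) \<le> A * exp (r * norm z)"
proof -
  obtain R where R: "R > 0" "\<And>p. rho p \<noteq> 0 \<Longrightarrow> norm p \<le> R" using P_class_support(3)[OF rho] by blast
  note i = P_class_integrable(1)[OF rho]
  have "norm (laplace rho z) \<le> (LINT p|lborel. \<bar>rho p\<bar>) * exp (2 * R * norm z)" for z
    unfolding laplace_def
  proof (rule integrable_times_bounded_on_support(2)[OF i])
    fix p assume p: "rho p \<noteq> 0"
    have "norm (exp (- z * plane_pt p)) \<le> exp (norm (- z * plane_pt p))" by (rule norm_exp)
    also have "norm (- z * plane_pt p) \<le> norm z * (2 * R)"
      using norm_plane_pt_le[of p] R(2)[OF p] by (auto simp: norm_mult intro!: mult_left_mono)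
    finally show "norm (exp (- z * plane_pt p)) \<le> exp (2 * R * norm z)" by (simp add: mult_ac)
  qed measurable
  then show ?thesis using R by (intro exI[of _ "LINT p|lborel. \<bar>rho p\<bar>"] conjI exI[of _ "2 * R"]) auto
qed

text \<open>The exponential series is integrated term by term. On the support |plane_pt p| \<le> 2
  R, so the moments \<open>c n\<close> are dominated by an exponential series and the resulting
  power series converges everywhere.\<close>

lemma laplace_holomorphic:
  assumes rho: "rho \<in> P_class a"
  shows "laplace rho holomorphic_on UNIV"
proof -
  obtain R where R: "R > 0" "\<And>p. rho p \<noteq> 0 \<Longrightarrow> norm p \<le> R" using P_class_support(3)[OF rho] by blast
  note i = P_class_integrable(1)[OF rho]
  define A where "A = (LINT p|lborel. \<bar>rho p\<bar>)"
  define c where "c = (\<lambda>n. LINT p|lborel. of_real (rho p) * ((- plane_pt p) ^ n / fact n))"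
  have pt: "norm (plane_pt p) \<le> 2 * R" if "rho p \<noteq> 0" for p
    using norm_plane_pt_le[of p] R(2)[OF that] by linarith
  have s: "(\<lambda>n. c n * w ^ n) sums laplace rho w" for w
  proof -
    define f where "f = (\<lambda>n p. of_real (rho p) * ((- plane_pt p * w) ^ n /\<^sub>R fact n))"
    have fb: "norm ((- plane_pt p * w) ^ n /\<^sub>R fact n) \<le> (2 * R * norm w) ^ n /\<^sub>R fact n"
      if "rho p \<noteq> 0" for n p
    proof -
      have "norm (- plane_pt p * w) ^ n \<le> (2 * R * norm w) ^ n"
        using pt[OF that] by (intro power_mono) (auto simp: norm_mult intro!: mult_right_mono)
      then show ?thesis by (simp add: norm_power divide_inverse[symmetric] divide_right_mono norm_divide field_simps)
    qed
    have fi: "integrable lborel (f n)" for n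
      unfolding f_def by (rule integrable_times_bounded_on_support(1)[OF i _ fb]) measurable
    have "(\<lambda>n. integral\<^sup>L lborel (f n)) sums (LINT p|lborel. (\<Sum>n. f n p))"
    proof (rule sums_integral[OF fi])
      show "AE p in lborel. summable (\<lambda>n. norm (f n p))"
      proof (rule AE_I2)
        fix p
        have "summable (\<lambda>n. norm (complex_of_real (rho p)) * norm ((- plane_pt p * w) ^ n /\<^sub>R fact n))"
          by (intro summable_mult summable_norm_exp)
        then show "summable (\<lambda>n. norm (f n p))" by (simp only: f_def norm_mult)
      qed
      show "summable (\<lambda>n. LINT p|lborel. norm (f n p))"
      proof (rule summable_comparison_test')
        show "summable (\<lambda>n. A * ((2 * R * norm w) ^ n /\<^sub>R fact n))"
          by (intro summable_mult summable_exp_generic)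
        fix n
        have "(LINT p|lborel. norm (f n p)) \<le> (LINT p|lborel. \<bar>rho p\<bar> * ((2 * R * norm w) ^ n /\<^sub>R fact n))"
        proof (rule integral_mono)
          fix p show "norm (f n p) \<le> \<bar>rho p\<bar> * ((2 * R * norm w) ^ n /\<^sub>R fact n)"
            unfolding f_def norm_mult norm_of_real
            by (cases "rho p = 0") (simp, intro mult_left_mono fb abs_ge_zero)
        qed (use fi i in auto)
        then show "norm (LINT p|lborel. norm (f n p)) \<le> A * ((2 * R * norm w) ^ n /\<^sub>R fact n)"
          by (simp add: A_def)
      qed
    qed
    moreover have "integral\<^sup>L lborel (f n) = c n * w ^ n" for n
      unfolding f_def c_def
      by (subst integral_mult_left_zero[symmetric], intro Bochner_Integration.integral_cong refl)
        (simp only: power_mult_distrib scaleR_conv_of_real, simp add: field_simps)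
    moreover have "(LINT p|lborel. (\<Sum>n. f n p)) = laplace rho w"
      unfolding laplace_def
    proof (intro Bochner_Integration.integral_cong refl)
      fix p
      have "(\<lambda>n. f n p) sums (of_real (rho p) * exp (- plane_pt p * w))"
        unfolding f_def by (intro sums_mult exp_converges)
      then show "(\<Sum>n. f n p) = of_real (rho p) * exp (- w * plane_pt p)"
        by (simp add: sums_unique[symmetric] mult.commute)
    qed
    ultimately show ?thesis by simp
  qed
  have "laplace rho holomorphic_on ball 0 r" for r
    by (rule power_series_holomorphic[where a = c]) (use s in simp)
  then have "laplace rho field_differentiable at z" for z
    by (rule holomorphic_on_imp_differentiable_at[of _ "ball 0 (norm z + 1)"]) auto
  then show ?thesis by (simp add: holomorphic_on_def field_differentiable_at_within)
qed

lemma I_k_continuous: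
  assumes rho: "rho \<in> P_class a" and a: "a > 0"
  shows "k \<noteq> 0 \<Longrightarrow> isCont (I_k rho) k" and "I_k rho \<in> borel_measurable borel"
proof -
  have cl: "continuous_on A (laplace rho)" for A
    using holomorphic_on_imp_continuous_on[OF laplace_holomorphic[OF rho]] continuous_on_subset by blast
  have c1: "continuous_on A (\<lambda>k. laplace rho (of_real k))" for A
    by (rule continuous_on_compose2[OF cl[of UNIV]]) (auto intro!: continuous_intros)
  have c2: "continuous_on A (\<lambda>k. cnj (laplace rho (of_real (- k))))" for A
    by (intro continuous_on_cnj, rule continuous_on_compose2[OF cl[of UNIV]]) (auto intro!: continuous_intros)
  have p: "continuous_on {0..} (I_k rho)"
    using c1 by (rule continuous_on_eq) (simp add: I_k_eq_laplace(1)[OF assms])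
  have n: "continuous_on {..0} (I_k rho)"
    using c2 by (rule continuous_on_eq) (simp add: I_k_eq_laplace(2)[OF assms])
  have "continuous_on ({..0} \<union> {0..}) (I_k rho)"
    using p n by (intro continuous_on_closed_Un) auto
  moreover have "{..0} \<union> {0..} = (UNIV :: real set)" by auto
  ultimately have "continuous_on UNIV (I_k rho)" by simp
  then show "k \<noteq> 0 \<Longrightarrow> isCont (I_k rho) k" "I_k rho \<in> borel_measurable borel"
    by (auto simp: continuous_on_eq_continuous_at borel_measurable_continuous_onI)
qed

section \<open>The potential in the slab\<close>

text \<open>Up to the factor \<open>\<bar>k\<bar> / (2 \<epsilon>\<^sub>s)\<close> this is \<open>\<bar>k\<bar> \<psi>\<^sup>+ + \<psi>\<^sup>-\<close>, the denominator of \<open>A\<^sub>k\<close>.\<close>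
definition V_denom :: "real \<Rightarrow> real \<Rightarrow> real \<Rightarrow> real \<Rightarrow> complex" where
  "V_denom a \<delta> m K = of_real (- \<delta> * (\<delta> + m) * exp (K * a))
     + Complex (- 2) (\<delta> - m) * Complex 2 (- \<delta>) * of_real (exp (- K * a))"

text \<open>With \<chi> = \<epsilon>s / \<epsilon>c, the coefficients (\<chi> + 1) / (2 \<chi>) and
  (\<chi> - 1) / (2 \<chi>) become (\<epsilon>s + \<epsilon>c) / (2 \<epsilon>s) and (\<epsilon>s -
  \<epsilon>c) / (2 \<epsilon>s). The near cancellation \<epsilon>s + \<epsilon>c = i (\<delta> +
  \<mu>) times 1 + \<epsilon>s = i \<delta> is the source of the small coefficient -\<delta>
  (\<delta> + \<mu>) in the denominator.\<close>

lemma V_hat_layer: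
  assumes k: "k \<noteq> 0" and x: "0 \<le> x" "x \<le> a" and m: "m = mu beta lam \<delta>"
  shows "V_hat a rho beta lam \<delta> x k =
    I_k rho k * of_real (exp (\<bar>k\<bar> * a)) / (of_real \<bar>k\<bar> * V_denom a \<delta> m \<bar>k\<bar>) *
    (Complex 0 (\<delta> + m) * of_real (exp (\<bar>k\<bar> * x)) + Complex (- 2) (\<delta> - m) * of_real (exp (- \<bar>k\<bar> * x)))"
proof -
  define es ec where "es = eps_s \<delta>" and "ec = eps_c beta lam \<delta>"
  define E where "E = complex_of_real (exp (\<bar>k\<bar> * a))"
  define X where "X = complex_of_real (exp (\<bar>k\<bar> * x))"
  define K where "K = complex_of_real \<bar>k\<bar>"
  define u v where "u = Complex 0 (\<delta> + m)" and "v = Complex (- 2) (\<delta> - m)"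
  have nz: "es \<noteq> 0" "ec \<noteq> 0" "E \<noteq> 0" "X \<noteq> 0" "K \<noteq> 0"
    using k by (auto simp: es_def ec_def E_def X_def K_def eps_s_def eps_c_def complex_eq_iff)
  have inv: "complex_of_real (exp (- (\<bar>k\<bar> * a))) = 1 / E" "complex_of_real (exp (- (\<bar>k\<bar> * x))) = 1 / X"
    by (simp_all add: E_def X_def exp_minus inverse_eq_divide)
  have ch: "chi_c beta lam \<delta> = es / ec" by (simp add: chi_c_def es_def ec_def)
  have uv: "es + ec = u" "es - ec = v" "u * (1 + es) = - of_real (\<delta> * (\<delta> + m))" "1 - es = Complex 2 (- \<delta>)"
    by (simp_all add: u_def v_def es_def ec_def eps_s_def eps_c_def m complex_eq_iff)
  have c1: "(es / ec + 1) / (2 * (es / ec)) = u / (2 * es)" "(es / ec - 1) / (2 * (es / ec)) = v / (2 * es)"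
    using nz unfolding uv[symmetric] by (simp_all add: field_simps)
  have gen: "1 / (2 * c) * (p * t + q * (1 / t)) = p / (2 * c) * t + q / (2 * c) / t"
    "r / (2 * c) * (p * t - q * (1 / t)) = r * (p / (2 * c) * t - q / (2 * c) / t)"
    "r / (2 * c) * (p * t + q * (1 / t)) = r * (p / (2 * c) * t + q / (2 * c) / t)" for c p q r t :: complex
    by (simp_all add: algebra_simps add_divide_distrib diff_divide_distrib)
  have pp: "psi_plus a beta lam \<delta> k = u / (2 * es) * E + v / (2 * es) / E"
    unfolding psi_plus_def ch Let_def c1[symmetric] mult_minus_left inv E_def[symmetric] by (rule gen)
  have pm: "psi_minus a beta lam \<delta> k = K * es * (u / (2 * es) * E - v / (2 * es) / E)"
    unfolding psi_minus_def ch Let_def c1[symmetric] mult_minus_left inv E_def[symmetric]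
      K_def[symmetric] es_def[symmetric] by (rule gen)
  have "2 * es * (K * psi_plus a beta lam \<delta> k + psi_minus a beta lam \<delta> k) = K * (u * (1 + es) * E + v * (1 - es) / E)"
    unfolding pp pm using nz by (simp add: field_simps)
  also have "\<dots> = K * V_denom a \<delta> m \<bar>k\<bar>"
    unfolding uv V_denom_def v_def using inv by (simp add: E_def)
  finally have den: "K * psi_plus a beta lam \<delta> k + psi_minus a beta lam \<delta> k = K * V_denom a \<delta> m \<bar>k\<bar> / (2 * es)"
    using nz by (simp add: field_simps)
  have A: "A_k a rho beta lam \<delta> k = I_k rho k * E * (2 * es) / (K * V_denom a \<delta> m \<bar>k\<bar>)"
    unfolding A_k_def K_def[symmetric] den using inv nz by simp
  have "V_hat a rho beta lam \<delta> x k = A_k a rho beta lam \<delta> k * (u / (2 * es) * X + v / (2 * es) / X)"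
    unfolding V_hat_def Let_def ch c1[symmetric] mult_minus_left inv X_def[symmetric]
    using k x by (simp only: gen not_less[symmetric] if_False if_True simp_thms)
  also have "\<dots> = I_k rho k * E / (K * V_denom a \<delta> m \<bar>k\<bar>) * (u * X + v / X)"
  proof -
    have "u / (2 * es) * X + v / (2 * es) / X = (u * X + v / X) / (2 * es)"
      by (simp add: add_divide_distrib)
    then show ?thesis unfolding A using nz by simp
  qed
  finally show ?thesis using inv by (simp add: E_def X_def K_def u_def v_def)
qed

text \<open>No cancellation can occur: the real parts of both terms are negative, the second being a
  positive multiple of -4 + \<delta> (\<delta> - m) < -3.\<close>

lemma V_denom_ge:
  assumes "0 < \<delta>" "\<delta> < 1" "0 \<le> m"
  shows "\<delta> * (\<delta> + m) * exp (K * a) \<le> norm (V_denom a \<delta> m K)" and "V_denom a \<delta> m K \<noteq> 0"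
proof -
  have "Re (V_denom a \<delta> m K) = - \<delta> * (\<delta> + m) * exp (K * a) + (- 4 + \<delta> * (\<delta> - m)) * exp (- K * a)"
    by (simp add: V_denom_def algebra_simps)
  moreover have "\<delta> * (\<delta> - m) < 1"
  proof -
    have "\<delta> * (\<delta> - m) \<le> \<delta> * \<delta>" using assms by (intro mult_left_mono) auto
    also have "\<dots> < 1" using assms mult_strict_mono[of \<delta> 1 \<delta> 1] by simp
    finally show ?thesis .
  qed
  then have "(- 4 + \<delta> * (\<delta> - m)) * exp (- K * a) < 0" by (intro mult_neg_pos) auto
  ultimately have "Re (V_denom a \<delta> m K) < - (\<delta> * (\<delta> + m) * exp (K * a))" by simp
  moreover have "0 < \<delta> * (\<delta> + m) * exp (K * a)" using assms by simp
  ultimately show "\<delta> * (\<delta> + m) * exp (K * a) \<le> norm (V_denom a \<delta> m K)" "V_denom a \<delta> m K \<noteq> 0"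
    using abs_Re_le_cmod[of "V_denom a \<delta> m K"] by auto
qed

lemma norm_Complex_neg2_le: "norm (Complex (- 2) t) \<le> 2 + \<bar>t\<bar>"
  using cmod_le[of "Complex (- 2) t"] by simp

lemma V_denom_le:
  assumes "0 < \<delta>" "\<delta> < 1" "0 \<le> m" "m \<le> 1"
  shows "norm (V_denom a \<delta> m K) \<le> \<delta> * (\<delta> + m) * exp (K * a) + 9 * exp (- K * a)"
proof -
  have 1: "norm (Complex (- 2) (\<delta> - m)) \<le> 3" using norm_Complex_neg2_le[of "\<delta> - m"] assms by simp
  have 2: "norm (Complex 2 (- \<delta>)) \<le> 3" using cmod_le[of "Complex 2 (- \<delta>)"] assms by simp
  have "norm (Complex (- 2) (\<delta> - m) * Complex 2 (- \<delta>)) \<le> 3 * 3"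
    unfolding norm_mult using 1 2 by (intro mult_mono) auto
  then have "norm (Complex (- 2) (\<delta> - m) * Complex 2 (- \<delta>) * of_real (exp (- K * a))) \<le> 9 * exp (- K * a)"
    unfolding norm_mult by (simp add: mult_right_mono)
  moreover have "norm (complex_of_real (- \<delta> * (\<delta> + m) * exp (K * a))) = \<delta> * (\<delta> + m) * exp (K * a)"
    using assms unfolding norm_of_real by (simp add: abs_mult)
  ultimately show ?thesis unfolding V_denom_def by (intro norm_triangle_le) linarith
qed

section \<open>Integrability in frequency, and the energy on a vertical slice\<close>

lemma integrable_exp_abs:
  fixes c :: real
  assumes "c > 0"
  shows "integrable lborel (\<lambda>k. exp (- c * \<bar>k\<bar>))"
proof -
  define f where "f = (\<lambda>k. indicator {0..} k * exp (- c * k))"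
  have "(\<lambda>k. exp (- c * k)) absolutely_integrable_on {0..}"
    using has_integral_exp_minus_to_infinity[OF assms, of 0]
    by (intro nonnegative_absolutely_integrable_1) auto
  then have f: "integrable lborel f"
    unfolding set_integrable_def f_def by (simp add: integrable_completion)
  then have f': "integrable lborel (\<lambda>k. f (- k))"
    using lborel_integrable_real_affine[OF f, of "-1" 0] by simp
  show ?thesis
    by (rule Bochner_Integration.integrable_bound[OF Bochner_Integration.integrable_add[OF f f']])
      (auto simp: f_def indicator_def)
qed

text \<open>The transfer factor in front of \<open>I_k\<close> grows at most like exp (|k| a), while
  \<open>I_k\<close> decays like exp (-|k| d0). The charge keeps the distance \<open>e\<close> = d0
  - a > 0 from the slab, so k h(k) decays exponentially.\<close>

lemma V_hat_layer_bounds: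
  assumes rho: "rho \<in> P_class a" and a: "a > 0" and \<delta>: "0 < \<delta>" "\<delta> < 1" and m: "0 \<le> mu beta lam \<delta>"
    and x: "0 \<le> x" "x \<le> a"
  defines "h \<equiv> V_hat a rho beta lam \<delta> x"
  shows "integrable lborel h" "integrable lborel (\<lambda>k. of_real k * h k)"
    and "\<exists>B. \<forall>k. norm (of_real k * h k) \<le> B"
    and "k \<noteq> 0 \<Longrightarrow> isCont (\<lambda>k. of_real k * h k) k"
proof -
  define \<mu> where "\<mu> = mu beta lam \<delta>"
  define s where "s = \<delta> + \<mu>"
  define w where "w = 2 + \<bar>\<delta> - \<mu>\<bar>"
  have s: "s > 0" and w: "w > 0" and \<mu>: "\<mu> \<ge> 0" using \<delta> m by (auto simp: s_def \<mu>_def w_def)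
  define H where "H = (\<lambda>k. I_k rho k * of_real (exp (\<bar>k\<bar> * a)) / (of_real \<bar>k\<bar> * V_denom a \<delta> \<mu> \<bar>k\<bar>) *
    (Complex 0 (\<delta> + \<mu>) * of_real (exp (\<bar>k\<bar> * x)) + Complex (- 2) (\<delta> - \<mu>) * of_real (exp (- \<bar>k\<bar> * x))))"
  have hH: "h k = (if k = 0 then 0 else H k)" for k
    unfolding h_def H_def using V_hat_layer[OF _ x \<mu>_def] by (auto simp: V_hat_def)
  note [measurable] = I_k_continuous(2)[OF rho a]
  have Hm: "H \<in> borel_measurable borel" unfolding H_def V_denom_def by measurable
  have hm[measurable]: "h \<in> borel_measurable borel" unfolding hH using Hm by measurable
  obtain C where C: "C \<ge> 0" "\<And>k. norm (I_k rho k) \<le> C * exp (- \<bar>k\<bar> * d0 rho)" "\<And>k. norm (I_k rho k) \<le> C * \<bar>k\<bar>"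
    using I_k_bounds[OF rho a] by blast
  define e where "e = d0 rho - a"
  have e: "e > 0" using P_class_support(1)[OF rho] by (simp add: e_def)
  define T where "T = (s + w) / (\<delta> * s)"
  have T: "T > 0" using s w \<delta> by (simp add: T_def)
  have hb: "norm (of_real k * h k) \<le> norm (I_k rho k) * exp (\<bar>k\<bar> * a) * T" for k
  proof (cases "k = 0")
    case False
    have "norm (Complex 0 (\<delta> + \<mu>) * of_real (exp (\<bar>k\<bar> * x)) + Complex (- 2) (\<delta> - \<mu>) * of_real (exp (- \<bar>k\<bar> * x)))
       \<le> s * exp (\<bar>k\<bar> * x) + w * exp (- \<bar>k\<bar> * x)"
    proof (rule norm_triangle_le)
      have "norm (Complex 0 (\<delta> + \<mu>)) = s" using s by (simp add: s_def norm_complex_def)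
      then show "norm (Complex 0 (\<delta> + \<mu>) * of_real (exp (\<bar>k\<bar> * x))) + norm (Complex (- 2) (\<delta> - \<mu>) * of_real (exp (- \<bar>k\<bar> * x)))
        \<le> s * exp (\<bar>k\<bar> * x) + w * exp (- \<bar>k\<bar> * x)"
        using norm_Complex_neg2_le[of "\<delta> - \<mu>"] by (simp add: norm_mult w_def)
    qed
    also have "\<dots> \<le> s * exp (\<bar>k\<bar> * a) + w * exp (\<bar>k\<bar> * a)"
    proof -
      have "- (\<bar>k\<bar> * x) \<le> \<bar>k\<bar> * a" using x a by (smt (verit) mult_nonneg_nonneg abs_ge_zero)
      then show ?thesis using s w x by (intro add_mono mult_left_mono) (auto intro: mult_left_mono)
    qed
    finally have 1: "norm (Complex 0 (\<delta> + \<mu>) * of_real (exp (\<bar>k\<bar> * x)) + Complex (- 2) (\<delta> - \<mu>) * of_real (exp (- \<bar>k\<bar> * x)))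
       \<le> (s + w) * exp (\<bar>k\<bar> * a)" by (simp add: distrib_right)
    have "norm (of_real k * h k) = norm (I_k rho k) * (exp (\<bar>k\<bar> * a) / norm (V_denom a \<delta> \<mu> \<bar>k\<bar>)) *
       norm (Complex 0 (\<delta> + \<mu>) * of_real (exp (\<bar>k\<bar> * x)) + Complex (- 2) (\<delta> - \<mu>) * of_real (exp (- \<bar>k\<bar> * x)))"
      using False by (simp only: hH H_def if_False norm_mult norm_divide norm_of_real) simp
    also have "\<dots> \<le> norm (I_k rho k) * (exp (\<bar>k\<bar> * a) / (\<delta> * s * exp (\<bar>k\<bar> * a))) * ((s + w) * exp (\<bar>k\<bar> * a))"
      using V_denom_ge(1)[OF \<delta> \<mu>, of "\<bar>k\<bar>" a] V_denom_ge(2)[OF \<delta> \<mu>, of a "\<bar>k\<bar>"] s \<delta>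
      by (intro mult_mono mult_left_mono divide_left_mono 1 mult_pos_pos) (auto simp: s_def)
    also have "\<dots> = norm (I_k rho k) * exp (\<bar>k\<bar> * a) * T" by (simp add: T_def)
    finally show ?thesis .
  qed (use T in simp)
  have gb: "norm (of_real k * h k) \<le> C * T * exp (- e * \<bar>k\<bar>)" for k
  proof -
    have "norm (of_real k * h k) \<le> (C * exp (- \<bar>k\<bar> * d0 rho)) * exp (\<bar>k\<bar> * a) * T"
      using hb[of k] C(2)[of k] T by (smt (verit, best) mult_right_mono exp_ge_zero)
    also have "\<dots> = C * T * exp (- e * \<bar>k\<bar>)"
      by (simp add: e_def exp_add[symmetric] algebra_simps)
    finally show ?thesis .
  qed
  \<comment> \<open>For |k| \<le> 1 the linear bound on \<open>I_k\<close> is divided by |k|; for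
    |k| > 1 the decay of k h(k) suffices. The factor exp (a + e) makes one majorant serve both
    ranges.\<close>
  have hb': "norm (h k) \<le> C * T * exp (a + e) * exp (- e * \<bar>k\<bar>)" for k
  proof (cases "k = 0")
    case True then show ?thesis using C T by (simp add: hH)
  next
    case False
    show ?thesis
    proof (cases "\<bar>k\<bar> \<le> 1")
      case True
      have "\<bar>k\<bar> * norm (h k) \<le> (C * \<bar>k\<bar>) * exp (\<bar>k\<bar> * a) * T"
        using hb[of k] C(3)[of k] T unfolding norm_mult norm_of_real
        by (smt (verit, best) mult_right_mono exp_ge_zero)
      then have "norm (h k) \<le> C * T * exp (\<bar>k\<bar> * a)" using False by (simp add: mult_ac)
      also have "\<dots> \<le> C * T * exp (a + e - e * \<bar>k\<bar>)"
      proof -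
        have "\<bar>k\<bar> * a \<le> a" "e * \<bar>k\<bar> \<le> e" using True a e by (auto simp: mult_left_le_one_le mult_left_le)
        then show ?thesis using C T by (intro mult_left_mono) auto
      qed
      also have "\<dots> = C * T * exp (a + e) * exp (- e * \<bar>k\<bar>)" by (simp add: exp_add[symmetric] mult.assoc)
      finally show ?thesis .
    next
      case False
      have "norm (h k) \<le> \<bar>k\<bar> * norm (h k)" using False by (simp add: mult_le_cancel_right1)
      also have "\<dots> \<le> C * T * exp (- e * \<bar>k\<bar>)" using gb[of k] by (simp add: norm_mult)
      also have "\<dots> = C * T * 1 * exp (- e * \<bar>k\<bar>)" by simp
      also have "\<dots> \<le> C * T * exp (a + e) * exp (- e * \<bar>k\<bar>)"
        using C T a e by (intro mult_right_mono mult_left_mono) auto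
      finally show ?thesis .
    qed
  qed
  note ex = integrable_exp_abs[OF e]
  show "integrable lborel h"
    by (rule Bochner_Integration.integrable_bound[of _ "\<lambda>k. C * T * exp (a + e) * exp (- e * \<bar>k\<bar>)"])
      (use ex hb' C T in \<open>auto intro: order_trans[OF _ abs_ge_self]\<close>)
  show "integrable lborel (\<lambda>k. of_real k * h k)"
    by (rule Bochner_Integration.integrable_bound[of _ "\<lambda>k. C * T * exp (- e * \<bar>k\<bar>)"])
      (use ex gb C T in \<open>auto intro: order_trans[OF _ abs_ge_self]\<close>)
  show "\<exists>B. \<forall>k. norm (of_real k * h k) \<le> B"
  proof (intro exI allI)
    fix k
    have "C * T * exp (- e * \<bar>k\<bar>) \<le> C * T * 1" using C T e by (intro mult_left_mono) auto
    then show "norm (of_real k * h k) \<le> C * T * 1" using gb[of k] by linarith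
  qed
  assume k: "k \<noteq> 0"
  have ci: "continuous_on (- {0}) (I_k rho)"
    using I_k_continuous(1)[OF rho a] by (auto intro!: continuous_at_imp_continuous_on)
  have "continuous_on (- {0}) (\<lambda>k. of_real k * H k)"
    unfolding H_def using V_denom_ge(2)[OF \<delta> \<mu>]
    by (intro continuous_intros ci) (auto simp: V_denom_def intro!: continuous_intros)
  then have "continuous_on (- {0}) (\<lambda>k. of_real k * h k)"
    by (rule continuous_on_eq) (simp add: hH)
  then show "isCont (\<lambda>k. of_real k * h k) k"
    using k by (simp add: continuous_on_eq_continuous_at open_Compl)
qed

text \<open>The y-derivative of V has transform i k \<open>V_hat\<close>, and the x-derivative
  contributes nonnegatively to the gradient. The constant 1 / (2 pi) combines the squared prefactor
  of \<open>V\<close> with the 2 pi of Plancherel.\<close>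

lemma grad_V_slice_lower_bound:
  assumes rho: "rho \<in> P_class a" and a: "a > 0" and \<delta>: "0 < \<delta>" "\<delta> < 1" and m: "0 \<le> mu beta lam \<delta>"
    and x: "0 \<le> x" "x \<le> a"
  shows "ennreal ((LINT k|lborel. (norm (of_real k * V_hat a rho beta lam \<delta> x k))\<^sup>2) / (2 * pi))
     \<le> (\<integral>\<^sup>+ y. ennreal (grad_V_sq a rho beta lam \<delta> x y) \<partial>lborel)"
proof -
  define h where "h = V_hat a rho beta lam \<delta> x"
  note hb = V_hat_layer_bounds[OF assms, folded h_def]
  obtain B where B: "\<And>k. norm (of_real k * h k) \<le> B" using hb(3) by blast
  define g where "g = (\<lambda>k. \<i> * of_real k * h k)"
  define G where "G = (\<lambda>y. LINT k|lborel. g k * exp (\<i> * of_real (k * y)))"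
  have gi: "integrable lborel g" using hb(2) by (simp add: g_def mult.assoc)
  then have [measurable]: "g \<in> borel_measurable borel" by simp
  have Gm[measurable]: "G \<in> borel_measurable borel" unfolding G_def by measurable
  have ng: "norm (g k) = norm (of_real k * h k)" for k by (simp add: g_def norm_mult)
  have "ennreal (2 * pi * (LINT k|lborel. (norm (g k))\<^sup>2)) \<le> (\<integral>\<^sup>+ y. ennreal ((norm (G y))\<^sup>2) \<partial>lborel)"
    unfolding G_def
  proof (rule fourier_integral_L2_lower_bound[OF gi])
    show "norm (g k) \<le> B" for k using B by (simp add: ng)
    \<comment> \<open>\<open>V_hat\<close> has an assigned value at k = 0, so continuity is claimed
      off this null set.\<close>
    have "isCont g k" if "k \<noteq> 0" for k
      unfolding g_def mult.assoc by (intro isCont_mult continuous_const hb(4) that)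
    moreover have "AE k in lborel. k \<noteq> (0::real)" by (rule AE_lborel_singleton)
    ultimately show "AE k in lborel. isCont g k" by (auto elim: eventually_mono)
  qed
  then have low: "ennreal (1 / (2 * pi)\<^sup>2) * ennreal (2 * pi * (LINT k|lborel. (norm (g k))\<^sup>2))
      \<le> ennreal (1 / (2 * pi)\<^sup>2) * (\<integral>\<^sup>+ y. ennreal ((norm (G y))\<^sup>2) \<partial>lborel)"
    by (rule mult_left_mono) simp
  have der: "vector_derivative (\<lambda>t. V a rho beta lam \<delta> (x, t)) (at y) = 1 / (2 * of_real pi) * G y" for y
  proof (rule vector_derivative_at)
    have "((\<lambda>t. 1 / (2 * of_real pi) * (LINT k|lborel. h k * exp (\<i> * of_real (k * t)))) has_vector_derivative
       1 / (2 * of_real pi) * G y) (at y)"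
      unfolding G_def g_def
      by (intro has_vector_derivative_mult_right has_vector_derivative_fourier_integral hb)
    then show "((\<lambda>t. V a rho beta lam \<delta> (x, t)) has_vector_derivative 1 / (2 * of_real pi) * G y) (at y)"
      by (simp add: V_def h_def)
  qed
  have "ennreal ((LINT k|lborel. (norm (g k))\<^sup>2) / (2 * pi))
      = ennreal (1 / (2 * pi)\<^sup>2) * ennreal (2 * pi * (LINT k|lborel. (norm (g k))\<^sup>2))"
    by (simp add: ennreal_mult'[symmetric] power2_eq_square)
  also note low
  also have "ennreal (1 / (2 * pi)\<^sup>2) * (\<integral>\<^sup>+ y. ennreal ((norm (G y))\<^sup>2) \<partial>lborel)
      = (\<integral>\<^sup>+ y. ennreal (1 / (2 * pi)\<^sup>2) * ennreal ((norm (G y))\<^sup>2) \<partial>lborel)"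
    by (rule nn_integral_cmult[symmetric]) measurable
  also have "\<dots> \<le> (\<integral>\<^sup>+ y. ennreal (grad_V_sq a rho beta lam \<delta> x y) \<partial>lborel)"
  proof (rule nn_integral_mono)
    fix y
    have "1 / (2 * pi)\<^sup>2 * (norm (G y))\<^sup>2 = (norm (1 / (2 * of_real pi) * G y))\<^sup>2"
      by (simp add: norm_mult norm_divide power_mult_distrib power_divide)
    also have "\<dots> \<le> grad_V_sq a rho beta lam \<delta> x y" unfolding grad_V_sq_def der by simp
    finally show "ennreal (1 / (2 * pi)\<^sup>2) * ennreal ((norm (G y))\<^sup>2) \<le> ennreal (grad_V_sq a rho beta lam \<delta> x y)"
      by (simp add: ennreal_mult'[symmetric] ennreal_leI)
  qed
  finally show ?thesis unfolding ng h_def .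
qed

section \<open>The power dissipation\<close>

text \<open>\<open>up\<close> and \<open>lo\<close> say that exp (-2 k0 a) balances \<delta>
  (\<delta> + \<mu>) up to the factor \<open>A\<close>. The denominator is then O(exp (-k0 a)), and
  near x = a the growing mode dominates with size about (\<delta> + \<mu>) exp (k0 a - 1). Together
  with exp (k a) in the numerator this gives exp (3 k0 a - 1).\<close>

lemma V_hat_layer_lower_bound:
  assumes \<delta>: "0 < \<delta>" "\<delta> < 1" and m: "0 \<le> mu beta lam \<delta>" "mu beta lam \<delta> \<le> 1"
    and a: "a > 0" and dstar: "dstar \<ge> 0" and A: "A \<ge> 1" and k0: "k0 \<ge> 1" "1 / k0 \<le> a"
    and up: "\<delta> * (\<delta> + mu beta lam \<delta>) \<le> A * exp (- 2 * k0 * a)"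
    and lo: "exp (- 2 * k0 * a) \<le> A * (\<delta> * (\<delta> + mu beta lam \<delta>))"
    and small: "6 * exp 2 * A * \<delta> \<le> 1"
    and k: "k0 \<le> k" "k \<le> k0 + 1" and x: "a - 1 / k0 \<le> x" "x \<le> a"
  shows "(\<delta> + mu beta lam \<delta>) * exp (3 * k0 * a - 1 - (k0 + 1) * dstar) / (2 * (A * exp a + 9))
      * (norm (I_k rho k) * exp (k * dstar))
    \<le> norm (of_real k * V_hat a rho beta lam \<delta> x k)"
proof -
  define \<mu> where "\<mu> = mu beta lam \<delta>"
  define s where "s = \<delta> + \<mu>"
  define CD where "CD = A * exp a + 9"
  define P where "P = norm (Complex 0 (\<delta> + \<mu>) * of_real (exp (k * x)) + Complex (- 2) (\<delta> - \<mu>) * of_real (exp (- k * x)))"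
  have \<mu>: "0 \<le> \<mu>" "\<mu> \<le> 1" using m by (simp_all add: \<mu>_def)
  have s: "s > 0" using \<delta> \<mu> by (simp add: s_def)
  have CD: "CD > 0" using A unfolding CD_def by (intro add_nonneg_pos) auto
  have x0: "x \<ge> 0" using x k0 by linarith
  have k0x: "k0 * a - 1 \<le> k0 * x"
    using mult_left_mono[OF x(1), of k0] k0 by (simp add: right_diff_distrib)
  have kx: "k0 * x \<le> k * x" using k x0 by (intro mult_right_mono) auto
  have ka: "k0 * a \<le> k * a" "k * a \<le> k0 * a + a"
    using k a mult_right_mono[of k "k0 + 1" a] by (auto simp: distrib_right intro: mult_right_mono)
  have P: "s * exp (k0 * a - 1) / 2 \<le> P"
  proof -
    have "norm (Complex (- 2) (\<delta> - \<mu>)) \<le> 3" using norm_Complex_neg2_le[of "\<delta> - \<mu>"] \<delta> \<mu> by simp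
    then have n2: "norm (Complex (- 2) (\<delta> - \<mu>) * of_real (exp (- k * x))) \<le> 3 * exp (- k * x)"
      by (simp add: norm_mult mult_right_mono)
    have n1: "norm (Complex 0 (\<delta> + \<mu>) * of_real (exp (k * x))) = s * exp (k * x)"
      using s by (simp add: norm_mult s_def norm_complex_def)
    \<comment> \<open>Since k x \<ge> k0 a - 1, the decaying mode is at most 3 exp 2 A \<delta>
      times the growing one by \<open>lo\<close>; \<open>small\<close> makes this at most one
      half.\<close>
    have "3 * exp (- k * x) = 3 * exp (- 2 * (k * x)) * exp (k * x)" by (simp add: exp_add[symmetric])
    also have "\<dots> \<le> 3 * exp (2 - 2 * k0 * a) * exp (k * x)"
      using kx k0x by (intro mult_right_mono mult_left_mono) auto
    also have "3 * exp (2 - 2 * k0 * a) = 3 * exp 2 * exp (- 2 * k0 * a)" by (simp add: exp_add[symmetric])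
    also have "\<dots> * exp (k * x) \<le> 3 * exp 2 * (A * (\<delta> * s)) * exp (k * x)"
      using lo by (intro mult_right_mono mult_left_mono) (auto simp: s_def \<mu>_def)
    also have "\<dots> = (6 * exp 2 * A * \<delta>) * (s * exp (k * x) / 2)" by simp
    also have "\<dots> \<le> 1 * (s * exp (k * x) / 2)" using small s by (intro mult_right_mono) auto
    finally have "s * exp (k * x) / 2 \<le> P"
      using norm_diff_ineq[of "Complex 0 (\<delta> + \<mu>) * of_real (exp (k * x))" "Complex (- 2) (\<delta> - \<mu>) * of_real (exp (- k * x))"]
        n1 n2 unfolding P_def by linarith
    moreover have "s * exp (k0 * a - 1) \<le> s * exp (k * x)" using s kx k0x by simp
    ultimately show ?thesis by linarith
  qed
  \<comment> \<open>As k exceeds k0 by at most 1, the first term of the denominator loses a factor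
    exp a; the second contributes the 9 of \<open>V_denom_le\<close>.\<close>
  have D: "norm (V_denom a \<delta> \<mu> k) \<le> CD * exp (- k0 * a)"
  proof -
    have "norm (V_denom a \<delta> \<mu> k) \<le> \<delta> * s * exp (k * a) + 9 * exp (- k * a)"
      using V_denom_le[OF \<delta> \<mu>] by (simp add: s_def)
    also have "\<dots> \<le> A * exp (- 2 * k0 * a) * exp (k0 * a + a) + 9 * exp (- k0 * a)"
    proof (rule add_mono)
      have "\<delta> * s \<le> A * exp (- 2 * k0 * a)" using up by (simp add: s_def \<mu>_def)
      then show "\<delta> * s * exp (k * a) \<le> A * exp (- 2 * k0 * a) * exp (k0 * a + a)"
        using ka A by (intro mult_mono[OF \<open>\<delta> * s \<le> _\<close>]) auto
    qed (use ka in simp)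
    also have "\<dots> = CD * exp (- k0 * a)" by (simp add: CD_def algebra_simps exp_add[symmetric])
    finally show ?thesis .
  qed
  have kpos: "k > 0" using k k0 by simp
  have nV: "norm (of_real k * V_hat a rho beta lam \<delta> x k) = norm (I_k rho k) * (exp (k * a) / norm (V_denom a \<delta> \<mu> k)) * P"
  proof -
    have "V_hat a rho beta lam \<delta> x k = I_k rho k * of_real (exp (k * a)) / (of_real k * V_denom a \<delta> \<mu> k) *
      (Complex 0 (\<delta> + \<mu>) * of_real (exp (k * x)) + Complex (- 2) (\<delta> - \<mu>) * of_real (exp (- k * x)))"
      using V_hat_layer[OF _ x0 x(2) \<mu>_def, of k rho] kpos by simp
    then show ?thesis using kpos unfolding P_def by (simp only: norm_mult norm_divide norm_of_real) simp
  qed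
  \<comment> \<open>Since \<open>dstar\<close> \<ge> 0 and k \<le> k0 + 1, the weight exp (-k dstar)
    is bounded below by a number independent of k, so the amplitude can leave the frequency
    integral.\<close>
  have "s * exp (3 * k0 * a - 1 - (k0 + 1) * dstar) / (2 * CD) * (norm (I_k rho k) * exp (k * dstar))
    \<le> s * exp (3 * k0 * a - 1 - k * dstar) / (2 * CD) * (norm (I_k rho k) * exp (k * dstar))"
    using s CD dstar k by (intro mult_right_mono divide_right_mono mult_left_mono) (auto intro: mult_right_mono)
  also have "\<dots> = norm (I_k rho k) * (s * (exp (3 * k0 * a - 1 - k * dstar) * exp (k * dstar)) / (2 * CD))"
    by simp
  also have "exp (3 * k0 * a - 1 - k * dstar) * exp (k * dstar) = exp (k0 * a) * exp (k0 * a) * exp (k0 * a - 1)"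
    by (simp add: exp_add[symmetric])
  also have "norm (I_k rho k) * (s * (exp (k0 * a) * exp (k0 * a) * exp (k0 * a - 1)) / (2 * CD))
    = norm (I_k rho k) * (exp (k0 * a) / (CD * exp (- k0 * a))) * (s * exp (k0 * a - 1) / 2)"
    by (simp add: exp_minus field_simps)
  also have "\<dots> \<le> norm (I_k rho k) * (exp (k * a) / norm (V_denom a \<delta> \<mu> k)) * P"
    using V_denom_ge(2)[OF \<delta> \<mu>(1), of a k] D CD ka s P
    by (intro mult_mono mult_left_mono frac_le) auto
  finally show ?thesis unfolding nV by (simp add: s_def CD_def \<mu>_def)
qed

text \<open>The slice bounds are integrated over the strip of width 1/k0, which lies in the region
  of \<open>E_xi\<close> because 1/k0 \<le> xi. The width supplies the factor 1/k0.\<close>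

lemma E_xi_lower_bound:
  assumes rho: "rho \<in> P_class a"
    and \<delta>: "0 < \<delta>" "\<delta> < 1" and m: "0 \<le> mu beta lam \<delta>" "mu beta lam \<delta> \<le> 1"
    and a: "a > 0" and dstar: "dstar \<ge> 0" and A: "A \<ge> 1" and k0: "k0 \<ge> 1" "1 / k0 \<le> a" "1 / k0 \<le> xi"
    and up: "\<delta> * (\<delta> + mu beta lam \<delta>) \<le> A * exp (- 2 * k0 * a)"
    and lo: "exp (- 2 * k0 * a) \<le> A * (\<delta> * (\<delta> + mu beta lam \<delta>))"
    and small: "6 * exp 2 * A * \<delta> \<le> 1"
  shows "ennreal (exp (- 2 - 2 * dstar) / (8 * pi * (A * exp a + 9)\<^sup>2 * A\<^sup>2) * exp (- 2 * k0 * (dstar - a)) / (\<delta> * k0)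
      * integral {k0..k0 + 1} (\<lambda>k. (norm (I_k rho k) * exp (k * dstar))\<^sup>2))
    \<le> E_xi a rho beta lam xi \<delta>"
proof -
  define s where "s = \<delta> + mu beta lam \<delta>"
  define CD where "CD = A * exp a + 9"
  define M where "M = s * exp (3 * k0 * a - 1 - (k0 + 1) * dstar) / (2 * CD)"
  define f where "f = (\<lambda>k. (norm (I_k rho k) * exp (k * dstar))\<^sup>2)"
  define Q where "Q = integral {k0..k0 + 1} f"
  have s: "s > 0" using \<delta> m by (simp add: s_def)
  have CD: "CD > 0" using A unfolding CD_def by (intro add_nonneg_pos) auto
  have M: "M \<ge> 0" using s CD by (simp add: M_def)
  have contf: "continuous_on {k0..k0 + 1} f"
    unfolding f_def using k0 by (intro continuous_intros continuous_at_imp_continuous_on ballI I_k_continuous(1)[OF rho a]) auto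
  have fint: "set_integrable lborel {k0..k0 + 1} f" using contf by (rule borel_integrable_atLeastAtMost')
  have Qeq: "Q = (LINT k:{k0..k0 + 1}|lborel. f k)"
    unfolding Q_def using fint by (rule set_borel_integral_eq_integral(2)[symmetric])
  have Q0: "Q \<ge> 0" unfolding Q_def by (intro integral_nonneg integrable_continuous_interval contf) (simp add: f_def)
  have slice: "ennreal (M\<^sup>2 * Q / (2 * pi)) \<le> (\<integral>\<^sup>+ y. ennreal (grad_V_sq a rho beta lam \<delta> x y) \<partial>lborel)"
    if x: "a - 1 / k0 \<le> x" "x \<le> a" for x
  proof -
    have x0: "x \<ge> 0" using x k0 by linarith
    note hb = V_hat_layer_bounds[OF rho a \<delta> m(1) x0 x(2)]
    define g where "g = (\<lambda>k. of_real k * V_hat a rho beta lam \<delta> x k)"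
    obtain B where B: "\<And>k. norm (g k) \<le> B" using hb(3) by (auto simp: g_def)
    have gi: "integrable lborel g" using hb(2) by (simp add: g_def)
    have g2: "integrable lborel (\<lambda>k. (norm (g k))\<^sup>2)"
    proof (rule Bochner_Integration.integrable_bound)
      show "integrable lborel (\<lambda>k. B * norm (g k))" using gi by simp
      show "AE k in lborel. norm ((norm (g k))\<^sup>2) \<le> norm (B * norm (g k))"
        using B by (auto simp: power2_eq_square abs_mult intro!: mult_right_mono order_trans[OF B abs_ge_self])
    qed (use gi in measurable)
    have "M\<^sup>2 * Q = (LINT k|lborel. M\<^sup>2 * (indicator {k0..k0 + 1} k *\<^sub>R f k))"
      unfolding Qeq set_lebesgue_integral_def by simp
    also have "\<dots> \<le> (LINT k|lborel. (norm (g k))\<^sup>2)"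
    proof (rule integral_mono)
      show "integrable lborel (\<lambda>k. M\<^sup>2 * (indicator {k0..k0 + 1} k *\<^sub>R f k))"
        using fint by (simp add: set_integrable_def)
      fix k
      show "M\<^sup>2 * (indicator {k0..k0 + 1} k *\<^sub>R f k) \<le> (norm (g k))\<^sup>2"
      proof (cases "k \<in> {k0..k0 + 1}")
        case True
        have "M * (norm (I_k rho k) * exp (k * dstar)) \<le> norm (g k)"
          using V_hat_layer_lower_bound[OF \<delta> m a dstar A k0(1,2) up lo small _ _ x, of k rho] True
          by (simp add: M_def s_def CD_def g_def)
        then have "(M * (norm (I_k rho k) * exp (k * dstar)))\<^sup>2 \<le> (norm (g k))\<^sup>2"
          using M by (intro power_mono) auto
        then show ?thesis using True by (simp add: f_def power_mult_distrib)
      qed simp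
    qed (rule g2)
    finally have "ennreal (M\<^sup>2 * Q / (2 * pi)) \<le> ennreal ((LINT k|lborel. (norm (g k))\<^sup>2) / (2 * pi))"
      by (intro ennreal_leI divide_right_mono) auto
    also have "\<dots> \<le> (\<integral>\<^sup>+ y. ennreal (grad_V_sq a rho beta lam \<delta> x y) \<partial>lborel)"
      unfolding g_def by (rule grad_V_slice_lower_bound[OF rho a \<delta> m(1) x0 x(2)])
    finally show ?thesis .
  qed
  have "exp (- 2 - 2 * dstar) / (8 * pi * CD\<^sup>2 * A\<^sup>2) * exp (- 2 * k0 * (dstar - a)) / (\<delta> * k0) * Q
      \<le> \<delta> * (M\<^sup>2 * Q / (2 * pi) * (1 / k0))"
  proof -
    \<comment> \<open>Squaring \<open>lo\<close> bounds s^2 below by exp (-4 k0 a) / (A^2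
      \<delta>^2). This eliminates \<mu>, and with the prefactor \<delta> of \<open>E_xi\<close> it
      leaves 1/\<delta>.\<close>
    have "exp (- 2 * k0 * a) * exp (- 2 * k0 * a) \<le> (A * (\<delta> * s)) * (A * (\<delta> * s))"
      using lo by (intro mult_mono) (auto simp: s_def[symmetric] intro: order_trans[OF exp_ge_zero])
    then have q: "exp (- 4 * k0 * a) \<le> A\<^sup>2 * \<delta>\<^sup>2 * s\<^sup>2"
      by (simp add: exp_add[symmetric] power2_eq_square mult_ac)
    have M2: "M\<^sup>2 = s\<^sup>2 * exp (6 * k0 * a - 2 - 2 * (k0 + 1) * dstar) / (4 * CD\<^sup>2)"
      unfolding M_def by (simp add: power_divide power_mult_distrib exp_double[symmetric] algebra_simps)
    have "exp (- 2 - 2 * dstar) * exp (- 2 * k0 * (dstar - a))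
        = exp (- 4 * k0 * a) * exp (6 * k0 * a - 2 - 2 * (k0 + 1) * dstar)"
      by (simp add: exp_add[symmetric] algebra_simps)
    also have "\<dots> \<le> A\<^sup>2 * \<delta>\<^sup>2 * s\<^sup>2 * exp (6 * k0 * a - 2 - 2 * (k0 + 1) * dstar)"
      using q by (rule mult_right_mono) simp
    also have "\<dots> = A\<^sup>2 * \<delta>\<^sup>2 * (4 * CD\<^sup>2) * M\<^sup>2" unfolding M2 using CD by simp
    finally have "exp (- 2 - 2 * dstar) * exp (- 2 * k0 * (dstar - a)) * Q / (8 * pi * CD\<^sup>2 * A\<^sup>2 * \<delta> * k0)
       \<le> A\<^sup>2 * \<delta>\<^sup>2 * (4 * CD\<^sup>2) * M\<^sup>2 * Q / (8 * pi * CD\<^sup>2 * A\<^sup>2 * \<delta> * k0)"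
      using Q0 k0 \<delta> by (intro divide_right_mono mult_right_mono) auto
    also have "\<dots> = \<delta> * (M\<^sup>2 * Q / (2 * pi) * (1 / k0))"
      using CD A \<delta> k0 by (simp add: field_simps power2_eq_square)
    finally show ?thesis by (simp add: mult_ac)
  qed
  then have "ennreal (exp (- 2 - 2 * dstar) / (8 * pi * CD\<^sup>2 * A\<^sup>2) * exp (- 2 * k0 * (dstar - a)) / (\<delta> * k0) * Q)
      \<le> ennreal (\<delta> * (M\<^sup>2 * Q / (2 * pi) * (1 / k0)))" by (rule ennreal_leI)
  also have "\<dots> = ennreal \<delta> * (ennreal (M\<^sup>2 * Q / (2 * pi)) * ennreal (1 / k0))"
    using \<delta> Q0 k0 by (simp only: ennreal_mult'' ennreal_mult' zero_le_divide_1_iff)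
  also have "ennreal (M\<^sup>2 * Q / (2 * pi)) * ennreal (1 / k0)
      = (\<integral>\<^sup>+ x. ennreal (M\<^sup>2 * Q / (2 * pi)) * indicator {a - 1 / k0..a} x \<partial>lborel)"
    using k0 by (subst nn_integral_cmult_indicator) auto
  also have "\<dots> \<le> (\<integral>\<^sup>+ x. indicator {a - xi..a} x * (\<integral>\<^sup>+ y. ennreal (grad_V_sq a rho beta lam \<delta> x y) \<partial>lborel) \<partial>lborel)"
    using slice k0 by (intro nn_integral_mono) (auto simp: indicator_def)
  finally show ?thesis by (simp add: E_xi_def Q_def f_def CD_def mult_left_mono)
qed

text \<open>Otherwise the squared mass on unit intervals is eventually at most c / k. By
  \<open>exp_type_small_mean_imp_tendsto_0\<close>, the weighted entire extension of
  \<open>I_k\<close> then tends to 0 along the real axis, against the positive upper limit.\<close>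

lemma frequently_I_k_mass:
  assumes rho: "rho \<in> P_class a" and a: "a > 0"
    and Lam: "0 < Limsup at_top (\<lambda>k. ereal (norm (I_k rho k) * exp (k * dstar)))"
  shows "\<exists>\<^sub>F k in at_top. c / k < integral {k..k + 1} (\<lambda>t. (norm (I_k rho t) * exp (t * dstar))\<^sup>2)"
proof (rule ccontr)
  assume "\<not> ?thesis"
  then have "\<forall>\<^sub>F k in at_top. integral {k..k + 1} (\<lambda>t. (norm (I_k rho t) * exp (t * dstar))\<^sup>2) \<le> c / k"
    by (simp add: not_frequently not_less)
  then obtain N where N: "\<And>k. k \<ge> N \<Longrightarrow> integral {k..k + 1} (\<lambda>t. (norm (I_k rho t) * exp (t * dstar))\<^sup>2) \<le> c / k"
    by (auto simp: eventually_at_top_linorder)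
  \<comment> \<open>Translation by \<open>T\<close> makes the eventual bound hold from 0 on; T \<ge>
    1 turns c / (k + T) into the required form with k + 1.\<close>
  define T where "T = max N 1"
  define F where "F = (\<lambda>z. laplace rho (z + of_real T) * exp ((z + of_real T) * of_real dstar))"
  have T: "T \<ge> 1" "T \<ge> N" by (auto simp: T_def)
  have nF: "norm (F (of_real t)) = norm (I_k rho (t + T)) * exp ((t + T) * dstar)" if "t \<ge> 0" for t
    using that T I_k_eq_laplace(1)[OF rho a, of "t + T"] by (simp add: F_def norm_mult)
  obtain A r where Ar: "A \<ge> 0" "r \<ge> 0" "\<And>z. norm (laplace rho z) \<le> A * exp (r * norm z)"
    using laplace_growth[OF rho] by blast
  define \<tau> where "\<tau> = r + \<bar>dstar\<bar>"
  have "((\<lambda>k. F (of_real k)) \<longlongrightarrow> 0) at_top"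
  proof (rule exp_type_small_mean_imp_tendsto_0[where C = "A * exp (\<tau> * T)" and \<tau> = \<tau> and c = "max c 1"])
    have "laplace rho \<circ> (\<lambda>z. z + of_real T) holomorphic_on UNIV"
      by (rule holomorphic_on_compose_gen[OF _ laplace_holomorphic[OF rho]]) (auto intro!: holomorphic_intros)
    then show "F holomorphic_on UNIV" unfolding F_def o_def by (intro holomorphic_intros)
    show "norm (F z) \<le> A * exp (\<tau> * T) * exp (\<tau> * norm z)" for z
    proof -
      have n: "norm (z + of_real T) \<le> norm z + T" using norm_triangle_ineq[of z "of_real T"] T by simp
      have "norm (F z) \<le> (A * exp (r * norm (z + of_real T))) * exp (norm ((z + of_real T) * of_real dstar))"
        unfolding F_def norm_mult[of "laplace _ _"] using Ar by (intro mult_mono norm_exp) auto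
      also have "\<dots> = A * exp (\<tau> * norm (z + of_real T))"
        unfolding norm_mult[of "z + of_real T"] norm_of_real \<tau>_def
        by (simp add: exp_add[symmetric] mult.assoc algebra_simps)
      also have "\<dots> \<le> A * exp (\<tau> * (norm z + T))"
        using Ar n by (intro mult_left_mono) (auto simp: \<tau>_def intro!: mult_left_mono)
      also have "\<dots> = A * exp (\<tau> * T) * exp (\<tau> * norm z)" by (simp add: exp_add[symmetric] mult.assoc algebra_simps)
      finally show ?thesis .
    qed
    show "integral {k..k + 1} (\<lambda>t. (norm (F (of_real t)))\<^sup>2) \<le> max c 1 / (k + 1)" if k: "k \<ge> 0" for k
    proof -
      let ?f = "\<lambda>t. (norm (I_k rho t) * exp (t * dstar))\<^sup>2"
      have "integral {k..k + 1} (\<lambda>t. ?f (t + T)) = integral {k + T..k + T + 1} ?f"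
        using integral_shift_Icc_real[of k "k + 1" ?f T] by (simp add: o_def add_ac)
      moreover have "integral {k..k + 1} (\<lambda>t. (norm (F (of_real t)))\<^sup>2) = integral {k..k + 1} (\<lambda>t. ?f (t + T))"
        using k nF by (intro integral_cong) auto
      ultimately have "integral {k..k + 1} (\<lambda>t. (norm (F (of_real t)))\<^sup>2) \<le> c / (k + T)"
        using N[of "k + T"] k T by simp
      also have "\<dots> \<le> max c 1 / (k + 1)" using k T by (intro frac_le) auto
      finally show ?thesis .
    qed
  qed (use Ar in \<open>auto simp: \<tau>_def\<close>)
  then have "((\<lambda>k. norm (F (of_real k))) \<longlongrightarrow> 0) at_top" by (rule tendsto_norm_zero)
  then have "((\<lambda>k. norm (I_k rho (k + T)) * exp ((k + T) * dstar)) \<longlongrightarrow> 0) at_top"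
    by (rule Lim_transform_eventually) (use nF in \<open>auto simp: eventually_at_top_linorder\<close>)
  moreover have "filterlim (\<lambda>k. k - T) at_top at_top" by real_asymp
  ultimately have "((\<lambda>k. norm (I_k rho (k - T + T)) * exp ((k - T + T) * dstar)) \<longlongrightarrow> 0) at_top"
    by (rule filterlim_compose)
  then have "((\<lambda>k. norm (I_k rho k) * exp (k * dstar)) \<longlongrightarrow> 0) at_top" by simp
  then have "((\<lambda>k. ereal (norm (I_k rho k) * exp (k * dstar))) \<longlongrightarrow> ereal 0) at_top"
    by (rule tendsto_ereal)
  from lim_imp_Limsup[OF _ this]
  have "Limsup at_top (\<lambda>k. ereal (norm (I_k rho k) * exp (k * dstar))) = 0" by simp
  with Lam show False by simp
qed

text \<open>For \<open>e\<^sup>-\<^sup>2\<^sup>k\<^sup>a = e\<^sup>p \<delta>\<^sup>r\<close> the two terms of the denominator balance; \<open>(p, r)\<close> is \<open>(0, 2)\<close> for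
  \<open>\<beta> \<ge> 1\<close> and \<open>(ln \<lambda>, \<beta> + 1)\<close> for \<open>\<beta> < 1\<close>.\<close>
lemma eventually_E_xi_lower_bound:
  assumes rho: "rho \<in> P_class a" and a: "a > 0" and dstar: "dstar \<ge> 0" and xi: "xi > 0" and r: "r > 0"
    and c0: "c0 > 0" and A: "A \<ge> 1"
    and reg: "\<forall>\<^sub>F \<delta> in at_right 0. 0 \<le> mu beta lam \<delta> \<and> mu beta lam \<delta> \<le> 1 \<and>
        \<delta> * (\<delta> + mu beta lam \<delta>) \<le> A * exp (p + r * ln \<delta>) \<and>
        exp (p + r * ln \<delta>) \<le> A * (\<delta> * (\<delta> + mu beta lam \<delta>))"
  defines "\<kappa> \<equiv> \<lambda>\<delta>. - (p + r * ln \<delta>) / (2 * a)"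
  shows "\<exists>c>0. \<forall>\<^sub>F \<delta> in at_right 0.
     c / \<kappa> \<delta> \<le> integral {\<kappa> \<delta>..\<kappa> \<delta> + 1} (\<lambda>k. (norm (I_k rho k) * exp (k * dstar))\<^sup>2) \<longrightarrow>
     ennreal (c0 * exp ((p + r * ln \<delta>) * ((dstar - a) / a)) / \<delta> / ((ln \<delta> - 1) * (p + r * ln \<delta>)))
       \<le> E_xi a rho beta lam xi \<delta>"
proof -
  define D where "D = exp (- 2 - 2 * dstar) / (8 * pi * (A * exp a + 9)\<^sup>2 * A\<^sup>2)"
  have "A * exp a + 9 > 0" using A by (intro add_nonneg_pos) auto
  then have D: "D > 0" unfolding D_def using A by (intro divide_pos_pos mult_pos_pos) auto
  \<comment> \<open>With this \<open>c\<close>, the claimed bound is at most D G / (\<delta> k) * (c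
    / k), which is the bound of \<open>E_xi_lower_bound\<close> with the mass replaced by c /
    k.\<close>
  define c where "c = c0 * (r + 1) / (4 * a\<^sup>2 * D)"
  have c: "c > 0" using c0 r a D by (simp add: c_def)
  have "filterlim \<kappa> at_top (at_right 0)" unfolding \<kappa>_def using r a by real_asymp
  then have "\<forall>\<^sub>F \<delta> in at_right 0. \<kappa> \<delta> \<ge> max 1 (max (1 / a) (1 / xi))" unfolding filterlim_at_top by blast
  moreover have "\<forall>\<^sub>F \<delta> in at_right 0. 6 * exp 2 * A * \<delta> < 1"
  proof -
    have "((\<lambda>\<delta>. 6 * exp 2 * A * \<delta>) \<longlongrightarrow> 6 * exp 2 * A * 0) (at_right 0)" by (intro tendsto_intros)
    then show ?thesis by (simp add: order_tendstoD)
  qed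
  moreover have "\<forall>\<^sub>F \<delta> in at_right 0. - ln \<delta> > \<bar>p\<bar>" by real_asymp
  moreover have "\<forall>\<^sub>F \<delta> in at_right 0. \<delta> > (0::real)" by (simp add: eventually_at_right_less)
  moreover have "\<forall>\<^sub>F \<delta> in at_right 0. \<delta> < (1::real)" by real_asymp
  ultimately have "\<forall>\<^sub>F \<delta> in at_right 0.
     c / \<kappa> \<delta> \<le> integral {\<kappa> \<delta>..\<kappa> \<delta> + 1} (\<lambda>k. (norm (I_k rho k) * exp (k * dstar))\<^sup>2) \<longrightarrow>
     ennreal (c0 * exp ((p + r * ln \<delta>) * ((dstar - a) / a)) / \<delta> / ((ln \<delta> - 1) * (p + r * ln \<delta>)))
       \<le> E_xi a rho beta lam xi \<delta>"
    using reg
  proof eventually_elim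
    case (elim \<delta>)
    define k where "k = \<kappa> \<delta>"
    define Q where "Q = integral {k..k + 1} (\<lambda>k. (norm (I_k rho k) * exp (k * dstar))\<^sup>2)"
    have k: "k \<ge> 1" "1 / a \<le> k" "1 / xi \<le> k" using elim by (auto simp: k_def)
    then have ka: "1 / k \<le> a" "1 / k \<le> xi" using a xi by (auto simp: field_simps)
    have pk: "p + r * ln \<delta> = - 2 * k * a" using a by (simp add: k_def \<kappa>_def field_simps)
    show ?case
    proof
      assume "c / \<kappa> \<delta> \<le> integral {\<kappa> \<delta>..\<kappa> \<delta> + 1} (\<lambda>k. (norm (I_k rho k) * exp (k * dstar))\<^sup>2)"
      then have Q: "c / k \<le> Q" by (simp add: k_def Q_def)
      define G where "G = exp (- 2 * k * (dstar - a))"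
      have G: "exp ((p + r * ln \<delta>) * ((dstar - a) / a)) = G" unfolding pk G_def using a by simp
      \<comment> \<open>As |p| < - ln \<delta>, the quantity 2 k a = -p - r ln \<delta> is at most
        (r + 1) (1 - ln \<delta>). The product of the two negative logarithmic factors is thus at
        least a multiple of k^2.\<close>
      have "2 * k * a \<le> (r + 1) * (1 - ln \<delta>)"
        using pk elim r by (simp add: algebra_simps)
      then have den: "4 * a\<^sup>2 * k\<^sup>2 / (r + 1) \<le> (1 - ln \<delta>) * (2 * k * a)"
      proof -
        have "4 * a\<^sup>2 * k\<^sup>2 / (r + 1) = (2 * k * a / (r + 1)) * (2 * k * a)" by (simp add: power2_eq_square)
        also have "\<dots> \<le> (1 - ln \<delta>) * (2 * k * a)"
          using \<open>2 * k * a \<le> _\<close> r k a by (intro mult_right_mono) (auto simp: field_simps)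
        finally show ?thesis .
      qed
      have "(ln \<delta> - 1) * (p + r * ln \<delta>) = (1 - ln \<delta>) * (2 * k * a)" unfolding pk by (simp add: algebra_simps)
      then have "c0 * exp ((p + r * ln \<delta>) * ((dstar - a) / a)) / \<delta> / ((ln \<delta> - 1) * (p + r * ln \<delta>))
         = c0 * G / \<delta> / ((1 - ln \<delta>) * (2 * k * a))" unfolding G by simp
      also have "\<dots> \<le> c0 * G / \<delta> / (4 * a\<^sup>2 * k\<^sup>2 / (r + 1))"
        using den c0 elim k a r by (intro divide_left_mono mult_pos_pos) (auto simp: G_def)
      also have "\<dots> = D * G / (\<delta> * k) * (c / k)"
        using D a k r elim by (simp add: c_def power2_eq_square mult_ac)
      also have "\<dots> \<le> D * G / (\<delta> * k) * Q"
        using Q D k elim by (intro mult_left_mono) (auto simp: G_def)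
      finally have "ennreal (c0 * exp ((p + r * ln \<delta>) * ((dstar - a) / a)) / \<delta> / ((ln \<delta> - 1) * (p + r * ln \<delta>)))
         \<le> ennreal (D * G / (\<delta> * k) * Q)" by (rule ennreal_leI)
      also have "\<dots> \<le> E_xi a rho beta lam xi \<delta>"
        unfolding D_def G_def Q_def
        by (rule E_xi_lower_bound) (use rho a dstar A k ka elim in \<open>auto simp: pk\<close>)
      finally show "ennreal (c0 * exp ((p + r * ln \<delta>) * ((dstar - a) / a)) / \<delta> / ((ln \<delta> - 1) * (p + r * ln \<delta>)))
         \<le> E_xi a rho beta lam xi \<delta>" .
    qed
  qed
  with c show ?thesis by blast
qed

text \<open>For \<beta> < 1 the term \<lambda> \<delta>^\<beta> dominates, and \<delta> (2 \<delta>
  + \<lambda> \<delta>^\<beta>) lies between \<lambda> \<delta>^(\<beta>+1) and 1 + 2/\<lambda>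
  times it. For \<beta> \<ge> 1 and small \<delta>, \<mu> \<ge> 0 puts \<delta> + \<mu> between
  \<delta> and (2 + |\<lambda>|) \<delta>.\<close>

lemma feasible_regime:
  assumes "beta > 0" and feas: "feasible beta lam"
  defines "p \<equiv> if beta < 1 then ln lam else 0" and "r \<equiv> if beta < 1 then beta + 1 else 2"
  shows "\<exists>A\<ge>1. \<forall>\<^sub>F \<delta> in at_right 0. 0 \<le> mu beta lam \<delta> \<and> mu beta lam \<delta> \<le> 1 \<and>
        \<delta> * (\<delta> + mu beta lam \<delta>) \<le> A * exp (p + r * ln \<delta>) \<and>
        exp (p + r * ln \<delta>) \<le> A * (\<delta> * (\<delta> + mu beta lam \<delta>))"
proof -
  have pos: "\<forall>\<^sub>F \<delta> in at_right 0. \<delta> > (0::real)" "\<forall>\<^sub>F \<delta> in at_right 0. \<delta> < (1::real)"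
    by real_asymp+
  have "((\<lambda>\<delta>. \<delta> powr beta) \<longlongrightarrow> 0) (at_right 0)" using \<open>beta > 0\<close> by real_asymp
  from tendsto_add[OF tendsto_ident_at tendsto_mult_right_zero[OF this]]
  have "((\<lambda>\<delta>. mu beta lam \<delta>) \<longlongrightarrow> 0) (at_right 0)" unfolding mu_def by simp
  then have le1: "\<forall>\<^sub>F \<delta> in at_right 0. mu beta lam \<delta> < 1" by (simp add: order_tendstoD)
  show ?thesis
  proof (cases "beta < 1")
    case True
    then have lam: "lam > 0" using feas by (simp add: feasible_def)
    have "\<forall>\<^sub>F \<delta> in at_right 0. 0 \<le> mu beta lam \<delta> \<and> mu beta lam \<delta> \<le> 1 \<and>
        \<delta> * (\<delta> + mu beta lam \<delta>) \<le> (1 + 2 / lam) * exp (p + r * ln \<delta>) \<and>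
        exp (p + r * ln \<delta>) \<le> (1 + 2 / lam) * (\<delta> * (\<delta> + mu beta lam \<delta>))"
      using pos le1
    proof eventually_elim
      case (elim \<delta>)
      define t where "t = \<delta> powr beta"
      have t: "t \<ge> \<delta>" unfolding t_def using elim True powr_mono'[of beta 1 \<delta>] by simp
      have q: "exp (p + r * ln \<delta>) = lam * (\<delta> * t)"
        using True lam elim by (simp add: p_def r_def exp_add t_def powr_def algebra_simps)
      have "\<delta> * \<delta> \<le> \<delta> * t" "\<delta> * t > 0" using t elim by (auto intro: mult_left_mono)
      moreover have "lam * (\<delta> * t) * (1 + 2 / lam) = lam * (\<delta> * t) + 2 * (\<delta> * t)"
        using lam by (simp add: field_simps)
      moreover have "\<delta> * (\<delta> + mu beta lam \<delta>) = 2 * (\<delta> * \<delta>) + lam * (\<delta> * t)"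
        by (simp add: mu_def t_def algebra_simps)
      ultimately have up: "\<delta> * (\<delta> + mu beta lam \<delta>) \<le> (1 + 2 / lam) * (lam * (\<delta> * t))"
        by (simp only: mult.commute[of "1 + 2 / lam"])
      have "lam * (\<delta> * t) \<le> \<delta> * (\<delta> + mu beta lam \<delta>)" and nonneg: "0 \<le> \<delta> * (\<delta> + mu beta lam \<delta>)"
        using lam elim by (simp_all add: mu_def t_def algebra_simps)
      have "lam * (\<delta> * t) \<le> 1 * (\<delta> * (\<delta> + mu beta lam \<delta>))"
        using \<open>lam * (\<delta> * t) \<le> _\<close> by simp
      also have "\<dots> \<le> (1 + 2 / lam) * (\<delta> * (\<delta> + mu beta lam \<delta>))"
        using lam nonneg by (intro mult_right_mono) auto
      finally show ?case using up lam elim unfolding q by (simp add: mu_def)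
    qed
    then show ?thesis using lam by (intro exI[of _ "1 + 2 / lam"]) auto
  next
    case False
    have nonneg: "\<forall>\<^sub>F \<delta> in at_right 0. 0 \<le> mu beta lam \<delta>"
    proof (cases "beta = 1")
      case True
      then have "lam \<ge> -1" using feas by (simp add: feasible_def)
      then have "0 \<le> mu beta lam \<delta>" if "\<delta> > 0" for \<delta>
        using that True mult_right_mono[of "-1" lam \<delta>] by (simp add: mu_def)
      then show ?thesis using pos(1) by (auto elim: eventually_mono)
    next
      case b: False
      have "((\<lambda>\<delta>. \<delta> powr (beta - 1)) \<longlongrightarrow> 0) (at_right 0)" using b False by real_asymp
      from tendsto_add[OF tendsto_const[of 1] tendsto_mult_right_zero[OF this, of lam]]
      have "((\<lambda>\<delta>. 1 + lam * \<delta> powr (beta - 1)) \<longlongrightarrow> 1) (at_right 0)" by simp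
      then have "\<forall>\<^sub>F \<delta> in at_right 0. 1 + lam * \<delta> powr (beta - 1) > 0" by (simp add: order_tendstoD)
      then show ?thesis using pos(1)
      proof eventually_elim
        case (elim \<delta>)
        \<comment> \<open>For \<beta> > 1 the correction is of lower order than \<delta>, so \<mu>
          has the sign of \<delta> whatever the sign of \<lambda>.\<close>
        have "mu beta lam \<delta> = \<delta> * (1 + lam * \<delta> powr (beta - 1))"
          using elim by (simp add: mu_def powr_diff field_simps)
        then show ?case using elim by simp
      qed
    qed
    have "\<forall>\<^sub>F \<delta> in at_right 0. 0 \<le> mu beta lam \<delta> \<and> mu beta lam \<delta> \<le> 1 \<and>
        \<delta> * (\<delta> + mu beta lam \<delta>) \<le> (2 + \<bar>lam\<bar>) * exp (p + r * ln \<delta>) \<and>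
        exp (p + r * ln \<delta>) \<le> (2 + \<bar>lam\<bar>) * (\<delta> * (\<delta> + mu beta lam \<delta>))"
      using pos le1 nonneg
    proof eventually_elim
      case (elim \<delta>)
      have q: "exp (p + r * ln \<delta>) = \<delta> * \<delta>"
        using False elim by (simp add: p_def r_def exp_double power2_eq_square)
      have "\<delta> powr beta \<le> \<delta>" using elim False powr_mono'[of 1 beta \<delta>] by simp
      then have "lam * \<delta> powr beta \<le> \<bar>lam\<bar> * \<delta>" by (intro mult_mono) auto
      then have "\<delta> + mu beta lam \<delta> \<le> (2 + \<bar>lam\<bar>) * \<delta>" by (simp add: mu_def algebra_simps)
      then have "\<delta> * (\<delta> + mu beta lam \<delta>) \<le> \<delta> * ((2 + \<bar>lam\<bar>) * \<delta>)" using elim by (intro mult_left_mono) auto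
      moreover have "1 * (\<delta> * \<delta>) \<le> (2 + \<bar>lam\<bar>) * (\<delta> * (\<delta> + mu beta lam \<delta>))"
        using elim by (intro mult_mono) auto
      ultimately show ?case using elim unfolding q by (simp add: mult_ac)
    qed
    then show ?thesis by (intro exI[of _ "2 + \<bar>lam\<bar>"]) auto
  qed
qed

section \<open>From frequencies back to values of \<delta>\<close>

theorem theorem4p3:
  fixes a beta lam xi C1 CL dstar :: real
    and rho :: "real \<times> real \<Rightarrow> real"
    and Lam :: ereal
  assumes "a > 0"
    and "rho \<in> P_class a"
    and "beta > 0"
    and "feasible beta lam"
    and "0 < xi" and "xi < a"
    and "C1 > 25" and "0 < CL" and "CL < 1"
    and "d0 rho \<le> dstar" and "dstar \<le> d1 rho"
    and "0 < Lam"
    and "Limsup at_top (\<lambda>k. ereal (norm (I_k rho k) * exp (k * dstar))) = Lam"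
  shows "\<forall>L::real. (ereal L = Lam \<or> (Lam = \<infinity> \<and> L > 0)) \<longrightarrow>
    (let C' = CL * exp (- 2 * dstar) / (2 * pi * C1);
         C2 = C' * a * L\<^sup>2 * lam powr ((dstar - a) / a) / 2;
         C3 = ln lam;
         C4 = C' * a * L\<^sup>2 / 4;
         bound = (\<lambda>\<delta>. if beta < 1
                   then C2 * \<delta> powr ((beta + 1) * ((dstar - a) / a) - 1)
                          / ((ln \<delta> - 1) * (C3 + (beta + 1) * ln \<delta>))
                   else C4 * \<delta> powr (2 * ((dstar - a) / a) - 1)
                          / ((ln \<delta> - 1) * ln \<delta>))
     in (\<exists>\<delta>s :: nat \<Rightarrow> real. \<delta>s \<longlonglongrightarrow> 0 \<and>
           (\<forall>j. 0 < \<delta>s j \<and> \<delta>s j < 1 \<and> 0 \<le> mu beta lam (\<delta>s j) \<and>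
                E_xi a rho beta lam xi (\<delta>s j) \<ge> ennreal (bound (\<delta>s j))))
        \<and> (((\<lambda>k. ereal (norm (I_k rho k) * exp (k * dstar))) \<longlongrightarrow> Lam) at_top \<longrightarrow>
             (\<forall>\<^sub>F \<delta> in at_right 0. E_xi a rho beta lam xi \<delta> \<ge> ennreal (bound \<delta>))))"
proof (intro allI impI, goal_cases)
  case (1 L)
  then have L: "L > 0" using \<open>0 < Lam\<close> by auto
  note a = \<open>a > 0\<close> and rho = \<open>rho \<in> P_class a\<close>
  define C' where "C' = CL * exp (- 2 * dstar) / (2 * pi * C1)"
  define bound where "bound = (\<lambda>\<delta>. if beta < 1
                   then C' * a * L\<^sup>2 * lam powr ((dstar - a) / a) / 2 * \<delta> powr ((beta + 1) * ((dstar - a) / a) - 1)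
                          / ((ln \<delta> - 1) * (ln lam + (beta + 1) * ln \<delta>))
                   else C' * a * L\<^sup>2 / 4 * \<delta> powr (2 * ((dstar - a) / a) - 1)
                          / ((ln \<delta> - 1) * ln \<delta>))"
  define p where "p = (if beta < 1 then ln lam else 0)"
  define r where "r = (if beta < 1 then beta + 1 else 2)"
  \<comment> \<open>Both cases share the factor \<open>c0\<close>: for \<beta> \<ge> 1 the
    denominator p + r ln \<delta> equals 2 ln \<delta>, hence 4 instead of 2. The extra decay 1/k of
    the claimed bound absorbs any positive value of \<open>c0\<close>.\<close>
  define c0 where "c0 = C' * a * L\<^sup>2 / 2"
  define \<kappa> where "\<kappa> = (\<lambda>\<delta>. - (p + r * ln \<delta>) / (2 * a))"
  \<comment> \<open>\<open>d\<close> inverts \<open>\<kappa>\<close> and tends to 0 from the right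
    as k tends to infinity, so properties of all small \<delta> transfer to all large k.\<close>
  define d where "d = (\<lambda>k. exp (- (2 * a * k + p) / r))"
  define Q where "Q = (\<lambda>k. integral {k..k + 1} (\<lambda>t. (norm (I_k rho t) * exp (t * dstar))\<^sup>2))"
  define Egood where "Egood = (\<lambda>\<delta>. ennreal (bound \<delta>) \<le> E_xi a rho beta lam xi \<delta>)"
  have r: "r > 0" using \<open>beta > 0\<close> by (simp add: r_def)
  have c0: "c0 > 0" using L a assms by (simp add: c0_def C'_def)
  have dstar: "dstar \<ge> 0" using P_class_support(1)[OF rho] a \<open>d0 rho \<le> dstar\<close> by linarith
  have bound_eq: "bound \<delta> = c0 * exp ((p + r * ln \<delta>) * ((dstar - a) / a)) / \<delta> / ((ln \<delta> - 1) * (p + r * ln \<delta>))"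
    if "\<delta> > 0" for \<delta>
  proof -
    define e where "e = (dstar - a) / a"
    show ?thesis
    proof (cases "beta < 1")
      case True
      then have lam: "lam > 0" using \<open>feasible beta lam\<close> by (simp add: feasible_def)
      have eq: "exp ((p + r * ln \<delta>) * e) / \<delta> = lam powr e * \<delta> powr ((beta + 1) * e - 1)"
        using True lam that
        by (simp add: p_def r_def powr_def exp_diff ring_distribs exp_add mult_ac left_diff_distrib)
      have "bound \<delta> = c0 * (exp ((p + r * ln \<delta>) * e) / \<delta>) / ((ln \<delta> - 1) * (p + r * ln \<delta>))"
        unfolding eq using True by (simp add: bound_def c0_def e_def p_def r_def)
      then show ?thesis by (simp add: e_def)
    next
      case False
      have eq: "exp ((p + r * ln \<delta>) * e) / \<delta> = \<delta> powr (2 * e - 1)"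
        using False that by (simp add: p_def r_def powr_diff) (simp add: powr_def mult_ac)
      have "bound \<delta> = c0 * (exp ((p + r * ln \<delta>) * e) / \<delta>) / ((ln \<delta> - 1) * (p + r * ln \<delta>))"
        unfolding eq using False by (simp add: bound_def c0_def e_def p_def r_def)
      then show ?thesis by (simp add: e_def)
    qed
  qed
  obtain A where A: "A \<ge> 1" and reg: "\<forall>\<^sub>F \<delta> in at_right 0. 0 \<le> mu beta lam \<delta> \<and> mu beta lam \<delta> \<le> 1 \<and>
        \<delta> * (\<delta> + mu beta lam \<delta>) \<le> A * exp (p + r * ln \<delta>) \<and>
        exp (p + r * ln \<delta>) \<le> A * (\<delta> * (\<delta> + mu beta lam \<delta>))"
    using feasible_regime[OF \<open>beta > 0\<close> \<open>feasible beta lam\<close>] unfolding p_def r_def by blast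
  obtain c where c: "c > 0" and ev: "\<forall>\<^sub>F \<delta> in at_right 0. c / \<kappa> \<delta> \<le> Q (\<kappa> \<delta>) \<longrightarrow>
     ennreal (c0 * exp ((p + r * ln \<delta>) * ((dstar - a) / a)) / \<delta> / ((ln \<delta> - 1) * (p + r * ln \<delta>)))
       \<le> E_xi a rho beta lam xi \<delta>"
    using eventually_E_xi_lower_bound[OF rho a dstar \<open>0 < xi\<close> r c0 A reg] unfolding \<kappa>_def Q_def by blast
  have pos: "\<forall>\<^sub>F \<delta> in at_right 0. \<delta> > (0::real)" "\<forall>\<^sub>F \<delta> in at_right 0. \<delta> < (1::real)"
    by real_asymp+
  have good: "\<forall>\<^sub>F \<delta> in at_right 0. c / \<kappa> \<delta> \<le> Q (\<kappa> \<delta>) \<longrightarrow> Egood \<delta>"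
    using ev pos(1) by eventually_elim (simp add: Egood_def bound_eq)
  have kd: "\<kappa> (d k) = k" for k using r a by (simp add: \<kappa>_def d_def field_simps)
  have d0: "filterlim d (at_right 0) at_top" unfolding d_def using r a by real_asymp
  have "\<forall>n::nat. \<exists>\<delta>. 0 < \<delta> \<and> \<delta> < 1 \<and> \<delta> < 1 / (real n + 1) \<and> 0 \<le> mu beta lam \<delta> \<and> Egood \<delta>"
  proof
    fix n :: nat
    have "\<forall>\<^sub>F \<delta> in at_right 0. \<delta> < 1 / (real n + 1)"
      by (rule eventually_at_right_real[THEN eventually_mono, of 0 "1 / (real n + 1)"]) auto
    with pos reg good have "\<forall>\<^sub>F \<delta> in at_right 0. 0 < \<delta> \<and> \<delta> < 1 \<and> \<delta> < 1 / (real n + 1) \<and> 0 \<le> mu beta lam \<delta>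
        \<and> (c / \<kappa> \<delta> \<le> Q (\<kappa> \<delta>) \<longrightarrow> Egood \<delta>)"
      by eventually_elim auto
    from eventually_compose_filterlim[OF this d0]
    have "\<forall>\<^sub>F k in at_top. 0 < d k \<and> d k < 1 \<and> d k < 1 / (real n + 1) \<and> 0 \<le> mu beta lam (d k)
        \<and> (c / k \<le> Q k \<longrightarrow> Egood (d k))" by (simp add: kd)
    \<comment> \<open>Arbitrarily large k have enough mass; among them some k satisfies all the
      eventual conditions, and \<delta> = \<open>d k\<close> is the next member of the
      sequence.\<close>
    moreover have "\<exists>\<^sub>F k in at_top. c / k < Q k"
      unfolding Q_def by (rule frequently_I_k_mass[OF rho a]) (use assms in simp)
    ultimately have "\<exists>\<^sub>F k in at_top. c / k < Q k \<and> 0 < d k \<and> d k < 1 \<and> d k < 1 / (real n + 1) \<and> 0 \<le> mu beta lam (d k)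
        \<and> (c / k \<le> Q k \<longrightarrow> Egood (d k))" by (rule frequently_eventually_frequently[rotated])
    then obtain k where "c / k < Q k \<and> 0 < d k \<and> d k < 1 \<and> d k < 1 / (real n + 1) \<and> 0 \<le> mu beta lam (d k)
        \<and> (c / k \<le> Q k \<longrightarrow> Egood (d k))" using frequently_ex by blast
    then show "\<exists>\<delta>. 0 < \<delta> \<and> \<delta> < 1 \<and> \<delta> < 1 / (real n + 1) \<and> 0 \<le> mu beta lam \<delta> \<and> Egood \<delta>"
      by (intro exI[of _ "d k"]) auto
  qed
  then obtain \<delta>s where \<delta>s: "\<And>n::nat. 0 < \<delta>s n \<and> \<delta>s n < 1 \<and> \<delta>s n < 1 / (real n + 1) \<and> 0 \<le> mu beta lam (\<delta>s n) \<and> Egood (\<delta>s n)"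
    by metis
  have "(\<lambda>n. 1 / (real n + 1)) \<longlonglongrightarrow> 0" by real_asymp
  then have "\<delta>s \<longlonglongrightarrow> 0"
    by (rule tendsto_sandwich[OF always_eventually always_eventually tendsto_const, rotated 2])
      (simp_all add: \<delta>s less_imp_le)
  moreover have "\<forall>\<^sub>F \<delta> in at_right 0. Egood \<delta>"
    if lim: "((\<lambda>k. ereal (norm (I_k rho k) * exp (k * dstar))) \<longlongrightarrow> Lam) at_top"
  proof -
    \<comment> \<open>A positive real below \<open>Lam\<close> exists also when \<open>Lam\<close>
      is infinite. It bounds |I_k| exp (k dstar) from below for large k, so the mass exceeds
      \<epsilon>^2, which is at least c / k once k \<ge> c / \<epsilon>^2.\<close>
    obtain \<epsilon> where \<epsilon>: "0 < ereal \<epsilon>" "ereal \<epsilon> < Lam" using \<open>0 < Lam\<close> ereal_dense2 by blast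
    have "\<forall>\<^sub>F k in at_top. ereal \<epsilon> < ereal (norm (I_k rho k) * exp (k * dstar))"
      using lim \<epsilon>(2) by (rule order_tendstoD)
    then obtain N where N: "\<And>k. k \<ge> N \<Longrightarrow> \<epsilon> < norm (I_k rho k) * exp (k * dstar)"
      by (auto simp: eventually_at_top_linorder)
    have Qge: "c / k \<le> Q k" if k: "k \<ge> max (max N 1) (c / \<epsilon>\<^sup>2)" for k
    proof -
      have "continuous_on {k..k + 1} (\<lambda>t. (norm (I_k rho t) * exp (t * dstar))\<^sup>2)"
        using k by (intro continuous_intros continuous_at_imp_continuous_on ballI I_k_continuous(1)[OF rho a]) auto
      then have "integral {k..k + 1} (\<lambda>t. \<epsilon>\<^sup>2) \<le> Q k"
        unfolding Q_def using k \<epsilon>(1) N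
        by (intro integral_le integrable_continuous_interval) (auto intro!: power_mono less_imp_le)
      moreover have "c / k \<le> \<epsilon>\<^sup>2" using k \<epsilon>(1) by (simp add: field_simps)
      ultimately show ?thesis by simp
    qed
    have "filterlim \<kappa> at_top (at_right 0)" unfolding \<kappa>_def using r a by real_asymp
    then have "\<forall>\<^sub>F \<delta> in at_right 0. \<kappa> \<delta> \<ge> max (max N 1) (c / \<epsilon>\<^sup>2)" unfolding filterlim_at_top by blast
    then show ?thesis using good by eventually_elim (use Qge in blast)
  qed
  ultimately have "(\<exists>\<delta>s :: nat \<Rightarrow> real. \<delta>s \<longlonglongrightarrow> 0 \<and>
           (\<forall>j. 0 < \<delta>s j \<and> \<delta>s j < 1 \<and> 0 \<le> mu beta lam (\<delta>s j) \<and>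
                E_xi a rho beta lam xi (\<delta>s j) \<ge> ennreal (bound (\<delta>s j))))
        \<and> (((\<lambda>k. ereal (norm (I_k rho k) * exp (k * dstar))) \<longlongrightarrow> Lam) at_top \<longrightarrow>
             (\<forall>\<^sub>F \<delta> in at_right 0. E_xi a rho beta lam xi \<delta> \<ge> ennreal (bound \<delta>)))"
    using \<delta>s unfolding Egood_def by (intro conjI exI[of _ \<delta>s] allI impI) auto
  then show ?case unfolding Let_def C'_def bound_def .
qed

end
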